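(* Let $N>r\ge 1$ and $n\ge 1$ be integers, let $A\in\mathbb{R}^{N\times r}$ with $\operatorname{rank}(A)=r$, and let $B\in\mathbb{R}^{N\times n}$. Let $p\in[0,1]^N$ be a probability distribution and assume there exists a fixed $\beta\in(0,1]$ such that $p_i\ge \beta\,\ell_i(A)/r$ for all $i\in[N]$. For any $\varepsilon,\delta\in(0,1)$, set $$s=\left\lceil \frac{r}{\beta}\max\left\{C\log(2r/\delta),\ \frac{4}{\delta\varepsilon}\right\}\right\rceil,\qquad C=\frac{\sqrt2}{\sqrt2-1-\log(2)/2}\approx 20.9080,$$ and let $S\in\mathbb{R}^{s\times N}$ be the random matrix $S\sim\mathrm{RandSample}(s,p)$. Let $X_{\mathrm{opt}}=\arg\min_{X\in\mathbb{R}^{r\times n}}\|AX-B\|_F^2$ and let $\widetilde X_{\mathrm{opt}}$ be a minimizer of $\|SAX-SB\|_F^2$ over $X\in\mathbb{R}^{r\times n}$. Then, with probability at least $1-\delta$, $$\|A\widetilde X_{\mathrm{opt}}-B\|_F^2\le(1+\varepsilon)\,\|AX_{\mathrm{opt}}-B\|_F^2 .$$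
   Context: $[N]=\{1,\dots,N\}$; $\log$ is the natural logarithm; $\|\cdot\|_F$ is the Frobenius norm. A vector $p\in[0,1]^N$ is a probability distribution if $\sum_{i=1}^N p_i=1$. Leverage scores: for $A\in\mathbb{R}^{N\times r}$ of rank $r$, let $U_A\in\mathbb{R}^{N\times r}$ be any matrix whose columns form an orthonormal basis of the column space of $A$; then $\ell_i(A)=\|U_A(i,:)\|_2^2$ for $i\in[N]$, where $U_A(i,:)$ is the $i$th row (independent of the choice of basis). RandSample: for $s\in\mathbb{N}$, $s\ge1$, and a probability distribution $p$, $S\sim\mathrm{RandSample}(s,p)$ means: draw independent indices $\xi^{(1)},\dots,\xi^{(s)}\in[N]$ with $\Pr(\xi^{(j)}=i)=p_i$, and let $S\in\mathbb{R}^{s\times N}$ have entries $S(j,i)=1/\sqrt{s\,p_i}$ if $\xi^{(j)}=i$ and $S(j,i)=0$ otherwise. *)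

theory Defs
  imports "HOL-Probability.Probability"
begin

definition frob_norm :: "real^'n^'m \<Rightarrow> real" where
  "frob_norm M = sqrt (\<Sum>i\<in>UNIV. \<Sum>j\<in>UNIV. (M $ i $ j)\<^sup>2)"

definition orthonormal_colspace_basis :: "real^'r^'N \<Rightarrow> real^'r^'N \<Rightarrow> bool" where
  "orthonormal_colspace_basis A U \<longleftrightarrow>
     (\<forall>j k. column j U \<bullet> column k U = (if j = k then 1 else 0)) \<and>
     span (columns U) = span (columns A)"

(* Meaningful only for rank A = CARD('r); then a basis matrix exists
   (orthonormal_colspace_basis_exists) and the choice of basis is irrelevant
   (leverage_eq). *)
definition leverage :: "real^'r^'N \<Rightarrow> 'N \<Rightarrow> real" where
  "leverage A i = (norm (row i (SOME U. orthonormal_colspace_basis A U)))\<^sup>2"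

lemma orthonormal_colspace_basis_exists:
  fixes A :: "real^'r^'N"
  assumes "rank A = CARD('r)"
  shows "\<exists>U. orthonormal_colspace_basis A U"
proof -
  have d: "dim (span (columns A)) = CARD('r)"
    using assms by (simp add: column_rank_def)
  obtain B where B: "B \<subseteq> span (columns A)" "pairwise orthogonal B"
    "\<And>x. x \<in> B \<Longrightarrow> norm x = 1" "independent B" "card B = dim (span (columns A))"
    "span B = span (columns A)"
    using orthonormal_basis_subspace[OF subspace_span[of "columns A"]] by metis
  have "finite B" using B(4) independent_imp_finite by blast
  then obtain f where f: "bij_betw f (UNIV :: 'r set) B"
    using finite_same_card_bij[of "UNIV :: 'r set" B] B(5) d by auto
  define U :: "real^'r^'N" where "U = (\<chi> i j. f j $ i)"
  have c: "column j U = f j" for j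
    by (simp add: U_def column_def vec_eq_iff)
  have "columns U = B"
    using f by (auto simp: columns_def c bij_betw_def)
  moreover have "f j \<bullet> f k = (if j = k then 1 else 0)" for j k
  proof -
    have "f j \<in> B" "f k \<in> B" using f by (auto simp: bij_betw_def)
    moreover have "j \<noteq> k \<Longrightarrow> f j \<noteq> f k" using f by (auto simp: bij_betw_def inj_on_def)
    ultimately show ?thesis
      using B(2,3) by (auto simp: pairwise_def orthogonal_def norm_eq_1)
  qed
  ultimately show ?thesis
    using B(6) by (intro exI[of _ U]) (simp add: orthonormal_colspace_basis_def c)
qed

lemma leverage_eq:
  fixes A U :: "real^'r^'N"
  assumes U: "orthonormal_colspace_basis A U"
  shows "leverage A i = (norm (row i U))\<^sup>2"
proof -
  define V where "V = (SOME U. orthonormal_colspace_basis A U)"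
  have V: "orthonormal_colspace_basis A V"
    unfolding V_def using U by (rule someI)
  define P where "P W = (\<Sum>k\<in>UNIV. (column k W $ i) *\<^sub>R column k W)" for W :: "real^'r^'N"
  have comp: "(norm (row i W))\<^sup>2 = P W $ i" for W :: "real^'r^'N"
    by (simp add: P_def power2_norm_eq_inner inner_vec_def row_def column_def)
  have mem: "P W \<in> span (columns A)" if "orthonormal_colspace_basis A W" for W
  proof -
    have "P W \<in> span (columns W)"
      unfolding P_def by (intro span_sum span_scale span_base) (auto simp: columns_def)
    with that show ?thesis by (simp add: orthonormal_colspace_basis_def)
  qed
  have orth: "(axis i 1 - P W) \<bullet> y = 0"
    if W: "orthonormal_colspace_basis A W" and y: "y \<in> span (columns A)" for W y
  proof -
    have "orthogonal (axis i 1 - P W) x" if x: "x \<in> columns W" for x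
    proof -
      obtain k where k: "x = column k W" using x unfolding columns_def by blast
      have "P W \<bullet> x = (\<Sum>j\<in>UNIV. (column j W $ i) * (if j = k then 1 else 0))"
        using W by (simp add: P_def k inner_sum_left orthonormal_colspace_basis_def)
      then have "P W \<bullet> x = x $ i" by (simp add: k if_distrib cong: if_cong)
      then show ?thesis
        by (simp add: orthogonal_def inner_diff_left inner_diff_right inner_axis inner_commute)
    qed
    then have "orthogonal (axis i 1 - P W) y"
      using W y orthogonal_to_span[of y "columns W"]
      by (auto simp: orthonormal_colspace_basis_def)
    then show ?thesis by (simp add: orthogonal_def)
  qed
  have "P U = P V"
  proof -
    have m: "P U - P V \<in> span (columns A)" using mem[OF U] mem[OF V] by (rule span_diff)
    have "(P U - P V) \<bullet> (P U - P V) = 0"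
      using orth[OF U m] orth[OF V m] by (simp add: inner_diff_left)
    then show ?thesis by simp
  qed
  then show ?thesis
    by (simp add: leverage_def comp flip: V_def)
qed

(* S is an s x N matrix with s a computed natural number, so it is encoded as the family
   of its rows: row j < s is the vector S j, and the rows j \<ge> s are zero. *)
definition sampling_matrix :: "nat \<Rightarrow> real^'N \<Rightarrow> (nat \<Rightarrow> 'N) \<Rightarrow> nat \<Rightarrow> real^'N" where
  "sampling_matrix s p \<xi> =
     (\<lambda>j. \<chi> i. if j < s \<and> \<xi> j = i then 1 / sqrt (real s * p $ i) else 0)"

definition RandSample :: "nat \<Rightarrow> real^'N \<Rightarrow> (nat \<Rightarrow> real^'N) pmf" where
  "RandSample s p =
     map_pmf (sampling_matrix s p) (Pi_pmf {..<s} undefined (\<lambda>_. embed_pmf (\<lambda>i. p $ i)))"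

(* Product S M of a row family S with an ordinary matrix M, again as a row family. *)
definition rows_mult :: "(nat \<Rightarrow> real^'m) \<Rightarrow> real^'n^'m \<Rightarrow> nat \<Rightarrow> real^'n" where
  "rows_mult S M = (\<lambda>j. S j v* M)"

definition rows_frob_norm :: "nat \<Rightarrow> (nat \<Rightarrow> real^'n) \<Rightarrow> real" where
  "rows_frob_norm s R = sqrt (\<Sum>j<s. \<Sum>k\<in>UNIV. (R j $ k)\<^sup>2)"

definition sample_const :: real where
  "sample_const = sqrt 2 / (sqrt 2 - 1 - ln 2 / 2)"

end

(* Write A = U H with U having orthonormal columns, let E be the least-squares residual, and let
   u_i, e_i be the rows of U and E.  With probability at least 1 - delta/2 the smallest eigenvalue
   of U^T S^T S U is at least 1/sqrt 2, and with probability at least 1 - delta/2 the matrix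
   T = U^T S^T S E satisfies |T|^2 <= (eps/2) |E|^2.  On both events the normal equations of the
   sketched problem give |Z| <= sqrt 2 |T| for the error Z = H (Xt - Xopt), and Pythagoras gives
   the claim.

   The bound on T is Markov's inequality for a sum of independent centred matrices.  The eigenvalue
   bound is a matrix Chernoff bound for sums W of rank-one summands x x^T.  In place of the trace of
   exp (- theta W) it uses the trace of (b - W)^k with b = k / theta, so that no functional calculus
   is needed; the sharp exponent is recovered as k tends to infinity. *)

theory Submission
  imports Defs "HOL-Real_Asymp.Real_Asymp"
begin

subsection \<open>Moments of self-adjoint operators\<close>

text \<open>The Loewner order \<open>lo\<close> \<le> \<open>f\<close> \<le> \<open>hi\<close> for
  self-adjoint \<open>f\<close>, written through quadratic forms so that eigenvalues never have to
  be produced.\<close>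

definition form_between :: "real \<Rightarrow> real \<Rightarrow> ('a::euclidean_space \<Rightarrow> 'a) \<Rightarrow> bool" where
  "form_between lo hi f \<longleftrightarrow> linear f \<and> (\<forall>x y. f x \<bullet> y = x \<bullet> f y) \<and>
     (\<forall>x. lo * (x \<bullet> x) \<le> x \<bullet> f x \<and> x \<bullet> f x \<le> hi * (x \<bullet> x))"

definition op_trace :: "('a::euclidean_space \<Rightarrow> 'a) \<Rightarrow> real" where
  "op_trace f = (\<Sum>b\<in>Basis. b \<bullet> f b)"

lemma linear_funpow:
  fixes f :: "'a::real_vector \<Rightarrow> 'a"
  assumes "linear f" shows "linear (f ^^ k)"
proof (induction k)
  case 0
  then show ?case by (simp add: linear_iff)
next
  case (Suc k)
  then show ?case using assms by (simp add: linear_iff)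
qed

lemma symmetric_funpow:
  assumes "\<And>x y. f x \<bullet> y = x \<bullet> f y"
  shows "(f ^^ k) x \<bullet> y = x \<bullet> (f ^^ k) y"
proof (induction k arbitrary: x y)
  case (Suc k)
  have "(f ^^ Suc k) x \<bullet> y = (f ^^ k) x \<bullet> f y" by (simp add: assms)
  also have "\<dots> = x \<bullet> (f ^^ Suc k) y" by (simp only: Suc funpow_Suc_right o_apply)
  finally show ?case .
qed simp

lemma inner_funpow_add:
  assumes "\<And>x y. f x \<bullet> y = x \<bullet> f y"
  shows "(f ^^ m) x \<bullet> (f ^^ n) y = x \<bullet> (f ^^ (m + n)) y"
  by (simp add: symmetric_funpow[OF assms] funpow_add)

lemma psd_funpow:
  assumes sym: "\<And>x y. f x \<bullet> y = x \<bullet> f y" and psd: "\<And>x. 0 \<le> x \<bullet> f x"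
  shows "0 \<le> x \<bullet> (f ^^ k) x"
proof (cases "even k")
  case True
  then obtain m where "k = m + m" by (metis evenE mult_2)
  then have "x \<bullet> (f ^^ k) x = (f ^^ m) x \<bullet> (f ^^ m) x" by (simp add: inner_funpow_add[OF sym])
  then show ?thesis by simp
next
  case False
  then obtain m where "k = m + Suc m" by (metis oddE mult_2 Suc_eq_plus1 add_Suc_right)
  then have "x \<bullet> (f ^^ k) x = (f ^^ m) x \<bullet> f ((f ^^ m) x)"
    using inner_funpow_add[OF sym, of m x "Suc m" x] by simp
  then show ?thesis by (simp add: psd)
qed

text \<open>The form at \<open>x + t *\<^sub>R y\<close> is a nonnegative polynomial in
  \<open>t\<close>, so its discriminant is not positive. Since \<open>f\<close> may be degenerate, a
  vanishing leading coefficient needs its own case.\<close>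

lemma Cauchy_Schwarz_psd:
  assumes lin: "linear f" and sym: "\<And>x y. f x \<bullet> y = x \<bullet> f y" and psd: "\<And>x. 0 \<le> x \<bullet> f x"
  shows "(x \<bullet> f y)\<^sup>2 \<le> (x \<bullet> f x) * (y \<bullet> f y)"
proof -
  have q: "0 \<le> x \<bullet> f x + 2 * t * (x \<bullet> f y) + t\<^sup>2 * (y \<bullet> f y)" for t
  proof -
    have "y \<bullet> f x = x \<bullet> f y" by (metis inner_commute sym)
    then show ?thesis
      using psd[of "x + t *\<^sub>R y"]
      by (simp add: linear_add[OF lin] linear_scale[OF lin] inner_simps power2_eq_square algebra_simps)
  qed
  define a b c where "a = x \<bullet> f x" and "b = x \<bullet> f y" and "c = y \<bullet> f y"
  have q': "0 \<le> a + 2 * t * b + t\<^sup>2 * c" for t using q unfolding a_def b_def c_def .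
  have c: "c \<ge> 0" by (simp add: c_def psd)
  have "b\<^sup>2 \<le> a * c"
  proof (cases "c = 0")
    case True
    have "b = 0"
    proof (rule ccontr)
      assume b: "b \<noteq> 0"
      \<comment> \<open>This \<open>t\<close> makes the remaining affine polynomial equal to
        -1.\<close>
      show False using q'[of "- (a + 1) / (2 * b)"] b True by (simp add: field_simps)
    qed
    then show ?thesis using True by simp
  next
    case False
    with c have "c > 0" by simp
    have "0 \<le> (a + 2 * (- b / c) * b + (- b / c)\<^sup>2 * c) * c" using q' c by (rule mult_nonneg_nonneg)
    also have "\<dots> = a * c - b\<^sup>2" using \<open>c > 0\<close> by (simp add: field_simps power2_eq_square)
    finally show ?thesis by simp
  qed
  then show ?thesis by (simp add: a_def b_def c_def)
qed

context
  fixes f :: "'a::euclidean_space \<Rightarrow> 'a" and lo hi :: real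
  assumes fb: "form_between lo hi f" and lo: "0 < lo"
begin

lemma form_between_linear: "linear f"
  and form_between_sym: "f x \<bullet> y = x \<bullet> f y"
  and form_between_lower: "lo * (x \<bullet> x) \<le> x \<bullet> f x"
  and form_between_upper: "x \<bullet> f x \<le> hi * (x \<bullet> x)"
  using fb by (auto simp: form_between_def)

lemma form_between_psd: "0 \<le> x \<bullet> f x"
  using form_between_lower[of x] lo by (smt (verit) inner_ge_zero mult_nonneg_nonneg)

text \<open>Cauchy-Schwarz for the semidefinite form of \<open>f ^^ m\<close> at the vectors
  \<open>x\<close> and \<open>f x\<close>.\<close>

lemma moment_log_convex: "(x \<bullet> (f ^^ Suc m) x)\<^sup>2 \<le> (x \<bullet> (f ^^ m) x) * (x \<bullet> (f ^^ Suc (Suc m)) x)"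
proof -
  have "f x \<bullet> (f ^^ m) (f x) = x \<bullet> (f ^^ Suc (Suc m)) x"
    by (simp only: form_between_sym funpow_Suc_right[of m f] funpow.simps o_apply funpow_swap1)
  moreover have "x \<bullet> (f ^^ m) (f x) = x \<bullet> (f ^^ Suc m) x"
    by (simp add: funpow_swap1)
  ultimately show ?thesis
    using Cauchy_Schwarz_psd[OF linear_funpow[OF form_between_linear, of m], of x "f x"]
      symmetric_funpow[OF form_between_sym] psd_funpow[OF form_between_sym form_between_psd]
    by simp
qed

text \<open>Log-convexity links three consecutive moments, so the induction carries the positivity
  of two of them.\<close>

lemma moment_pos:
  assumes "norm x = 1"
  shows "0 < x \<bullet> (f ^^ m) x \<and> 0 < x \<bullet> (f ^^ Suc m) x"
proof (induction m)
  case 0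
  have "x \<bullet> x = 1" using assms by (simp add: norm_eq_1)
  then show ?case using form_between_lower[of x] lo by simp
next
  case (Suc m)
  then have "0 < (x \<bullet> (f ^^ Suc m) x)\<^sup>2" by simp
  then have "0 < (x \<bullet> (f ^^ m) x) * (x \<bullet> (f ^^ Suc (Suc m)) x)"
    using moment_log_convex by (rule less_le_trans)
  with Suc show ?case by (auto simp: zero_less_mult_iff)
qed

text \<open>Log-convexity makes the ratios of consecutive moments increasing; the zeroth moment is 1.\<close>

lemma moment_supermult:
  assumes x: "norm x = 1"
  shows "(x \<bullet> (f ^^ i) x) * (x \<bullet> (f ^^ j) x) \<le> x \<bullet> (f ^^ (i + j)) x"
proof -
  define h where "h m = x \<bullet> (f ^^ m) x" for m
  have pos: "h m > 0" for m using moment_pos[OF x] by (simp add: h_def)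
  have "h (Suc m) / h m \<le> h (Suc (Suc m)) / h (Suc m)" for m
    using moment_log_convex[of x m] pos[of m] pos[of "Suc m"]
    by (simp add: divide_simps h_def power2_eq_square mult.commute del: funpow.simps)
  then have mono: "h (Suc m) / h m \<le> h (Suc n) / h n" if "m \<le> n" for m n
    using lift_Suc_mono_le[of "\<lambda>m. h (Suc m) / h m"] that by blast
  have "h i * h j \<le> h (i + j)"
  proof (induction j)
    case 0
    show ?case using x by (simp add: h_def norm_eq_1)
  next
    case (Suc j)
    have "h i * h (Suc j) = (h i * h j) * (h (Suc j) / h j)" using pos[of j] by simp
    also have "\<dots> \<le> h (i + j) * (h (Suc (i + j)) / h (i + j))"
      using Suc mono[of j "i + j"] pos by (intro mult_mono) (auto intro: less_imp_le)
    also have "\<dots> = h (i + Suc j)" using pos[of "i + j"] by simp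
    finally show ?case .
  qed
  then show ?thesis by (simp add: h_def)
qed

text \<open>Jensen's inequality for the spectral distribution of \<open>f\<close> at
  \<open>x\<close>, obtained without a spectral theorem by splitting off one factor at a
  time.\<close>

lemma moment_power_le:
  assumes x: "norm x = 1"
  shows "(x \<bullet> f x) ^ k \<le> x \<bullet> (f ^^ k) x"
proof (induction k)
  case 0
  then show ?case using x by (simp add: norm_eq_1)
next
  case (Suc k)
  have "(x \<bullet> f x) ^ Suc k \<le> (x \<bullet> f x) * (x \<bullet> (f ^^ k) x)"
    using Suc form_between_psd by (simp add: mult_left_mono)
  also have "\<dots> \<le> x \<bullet> (f ^^ Suc k) x" using moment_supermult[OF x, of 1 k] by simp
  finally show ?case .
qed

text \<open>The odd order allows a symmetric split: with \<open>y = (f ^^ m) x\<close> the claim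
  compares \<open>f y \<bullet> f y\<close> with \<open>y \<bullet> f y\<close>. Cauchy-Schwarz for
  the form of \<open>f\<close> at \<open>f y\<close> and \<open>y\<close> yields it after cancelling
  \<open>f y \<bullet> f y\<close>.\<close>

lemma moment_le_upper:
  "x \<bullet> (f ^^ (Suc (Suc (2 * m)))) x \<le> hi * (x \<bullet> (f ^^ Suc (2 * m)) x)"
proof -
  define y where "y = (f ^^ m) x"
  have *: "(f y \<bullet> f y)\<^sup>2 \<le> (f y \<bullet> f (f y)) * (y \<bullet> f y)"
    using Cauchy_Schwarz_psd[OF form_between_linear form_between_sym form_between_psd, of "f y" y]
    by simp
  also have "\<dots> \<le> (hi * (f y \<bullet> f y)) * (y \<bullet> f y)"
    using form_between_upper form_between_psd by (intro mult_right_mono)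
  finally have "(f y \<bullet> f y) * (f y \<bullet> f y) \<le> (f y \<bullet> f y) * (hi * (y \<bullet> f y))"
    by (simp add: power2_eq_square mult_ac)
  then have "f y \<bullet> f y \<le> hi * (y \<bullet> f y)"
  proof (cases "f y = 0")
    case True
    then show ?thesis by simp
  next
    case False
    then have "f y \<bullet> f y > 0" by simp
    then show ?thesis using \<open>(f y \<bullet> f y) * (f y \<bullet> f y) \<le> _\<close> by (simp only: mult_le_cancel_left_pos)
  qed
  moreover have "f y \<bullet> f y = x \<bullet> (f ^^ (Suc (Suc (2 * m)))) x"
    using inner_funpow_add[OF form_between_sym, of "Suc m" x "Suc m" x] by (simp add: y_def mult_2)
  moreover have "y \<bullet> f y = x \<bullet> (f ^^ Suc (2 * m)) x"
    using inner_funpow_add[OF form_between_sym, of "m" x "Suc m" x] by (simp add: y_def mult_2)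
  ultimately show ?thesis by (simp only:)
qed

text \<open>For even powers both sides are sums of squares, compared one coordinate at a time by
  Cauchy-Schwarz. This replaces the fact that the trace dominates the largest eigenvalue.\<close>

lemma moment_le_op_trace:
  assumes x: "norm x = 1"
  shows "x \<bullet> (f ^^ (2 * m)) x \<le> op_trace (f ^^ (2 * m))"
proof -
  let ?g = "f ^^ m"
  have "x \<bullet> (f ^^ (2 * m)) x = ?g x \<bullet> ?g x"
    using inner_funpow_add[OF form_between_sym, of m x m x] by (simp add: mult_2)
  also have "\<dots> = (\<Sum>b\<in>Basis. (?g x \<bullet> b)\<^sup>2)"
    by (subst euclidean_inner) (simp add: power2_eq_square)
  also have "\<dots> \<le> (\<Sum>b\<in>Basis. (?g b \<bullet> ?g b))"
  proof (rule sum_mono)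
    fix b :: 'a
    have "(?g x \<bullet> b)\<^sup>2 = (x \<bullet> ?g b)\<^sup>2" by (simp add: symmetric_funpow[OF form_between_sym])
    also have "\<dots> \<le> ?g b \<bullet> ?g b"
      using Cauchy_Schwarz_ineq[of x "?g b"] x by (simp add: norm_eq_1)
    finally show "(?g x \<bullet> b)\<^sup>2 \<le> ?g b \<bullet> ?g b" .
  qed
  also have "\<dots> = op_trace (f ^^ (2 * m))"
    using inner_funpow_add[OF form_between_sym, of m _ m] by (simp add: op_trace_def mult_2)
  finally show ?thesis .
qed

lemma op_trace_funpow_nonneg: "0 \<le> op_trace (f ^^ k)"
  unfolding op_trace_def by (intro sum_nonneg psd_funpow form_between_sym form_between_psd)

end

text \<open>One sample changes the residual operator by such a step with \<open>c = 1\<close>.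
  Keeping \<open>c\<close> free allows differentiation along the path that starts from
  \<open>f\<close> at \<open>c = 0\<close>.\<close>

definition rank1_down :: "('a::real_inner \<Rightarrow> 'a) \<Rightarrow> 'a \<Rightarrow> real \<Rightarrow> 'a \<Rightarrow> 'a" where
  "rank1_down f u c = (\<lambda>x. f x - (c * (u \<bullet> x)) *\<^sub>R u)"

lemma rank1_down_linear: "linear f \<Longrightarrow> linear (rank1_down f u c)"
  by (simp add: linear_iff rank1_down_def inner_simps algebra_simps)

lemma rank1_down_0 [simp]: "rank1_down f u 0 = f"
  by (simp add: rank1_down_def)

lemma form_between_lower_mono:
  assumes "form_between lo hi f" "lo' \<le> lo"
  shows "form_between lo' hi f"
  using assms unfolding form_between_def by (meson inner_ge_zero mult_right_mono order_trans)

lemma form_between_rank1_down: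
  assumes "form_between lo hi f" "0 \<le> c"
  shows "form_between (lo - c * (u \<bullet> u)) hi (rank1_down f u c)"
proof -
  note fb = assms(1)[unfolded form_between_def]
  have "linear (rank1_down f u c)" using fb by (simp add: rank1_down_linear)
  moreover have "rank1_down f u c x \<bullet> y = x \<bullet> rank1_down f u c y" for x y
    using fb by (simp add: rank1_down_def inner_simps inner_commute)
  moreover have "(lo - c * (u \<bullet> u)) * (x \<bullet> x) \<le> x \<bullet> rank1_down f u c x \<and>
     x \<bullet> rank1_down f u c x \<le> hi * (x \<bullet> x)" for x
  proof -
    have e: "x \<bullet> rank1_down f u c x = x \<bullet> f x - c * (u \<bullet> x)\<^sup>2"
      by (simp add: rank1_down_def inner_simps inner_commute power2_eq_square)
    have "c * (u \<bullet> x)\<^sup>2 \<le> c * ((u \<bullet> u) * (x \<bullet> x))"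
      using assms(2) Cauchy_Schwarz_ineq by (rule mult_left_mono[rotated])
    moreover have "0 \<le> c * (u \<bullet> x)\<^sup>2" using assms(2) by simp
    moreover have "lo * (x \<bullet> x) \<le> x \<bullet> f x" "x \<bullet> f x \<le> hi * (x \<bullet> x)" using fb by auto
    ultimately show ?thesis unfolding e by (auto simp: algebra_simps)
  qed
  ultimately show ?thesis by (simp add: form_between_def)
qed

text \<open>Product rule for non-commuting factors: one factor is replaced by minus the rank-one
  operator of \<open>u\<close>, with \<open>i\<close> factors to its left and
  \<open>k - 1 - i\<close> to its right.\<close>

lemma funpow_rank1_down_derivative:
  fixes f :: "'a::euclidean_space \<Rightarrow> 'a"
  assumes lin: "linear f"
  shows "((\<lambda>c. (rank1_down f u c ^^ k) x) has_vector_derivative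
     (- (\<Sum>i<k. (u \<bullet> (rank1_down f u c ^^ (k - 1 - i)) x) *\<^sub>R (rank1_down f u c ^^ i) u))) (at c)"
proof (induction k)
  case 0
  show ?case by simp
next
  case (Suc k)
  let ?N = "rank1_down f u c"
  define d where "d = - (\<Sum>i<k. (u \<bullet> (?N ^^ (k - 1 - i)) x) *\<^sub>R (?N ^^ i) u)"
  have IH: "((\<lambda>c. (rank1_down f u c ^^ k) x) has_vector_derivative d) (at c)"
    using Suc by (simp add: d_def)
  have bl: "bounded_linear f" using lin by (simp add: linear_conv_bounded_linear)
  have F: "((\<lambda>c. u \<bullet> (rank1_down f u c ^^ k) x) has_real_derivative (u \<bullet> d)) (at c)"
    using bounded_linear.has_vector_derivative[OF bounded_linear_inner_right[of u] IH]
    by (simp add: has_real_derivative_iff_has_vector_derivative)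
  have G: "((\<lambda>c. c * (u \<bullet> (rank1_down f u c ^^ k) x)) has_real_derivative
      (u \<bullet> (?N ^^ k) x) + c * (u \<bullet> d)) (at c)"
    by (rule derivative_eq_intros F refl | simp)+
  have "((\<lambda>c. (rank1_down f u c ^^ Suc k) x) has_vector_derivative
      f d - ((u \<bullet> (?N ^^ k) x) + c * (u \<bullet> d)) *\<^sub>R u) (at c)"
    using has_vector_derivative_diff[OF bounded_linear.has_vector_derivative[OF bl IH]
        bounded_linear.has_vector_derivative[OF bounded_linear_scaleR_left[of u]
         G[unfolded has_real_derivative_iff_has_vector_derivative]]]
    by (simp add: rank1_down_def[of f u])
  moreover have "f d - ((u \<bullet> (?N ^^ k) x) + c * (u \<bullet> d)) *\<^sub>R u = ?N d - (u \<bullet> (?N ^^ k) x) *\<^sub>R u"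
    by (simp add: rank1_down_def algebra_simps)
  moreover have "?N d = - (\<Sum>i<k. (u \<bullet> (?N ^^ (k - 1 - i)) x) *\<^sub>R (?N ^^ Suc i) u)"
  proof -
    note l = rank1_down_linear[OF lin, of u c]
    show ?thesis by (simp add: d_def linear_neg[OF l] linear_sum[OF l] linear_scale[OF l])
  qed
  moreover have "(\<Sum>i<Suc k. (u \<bullet> (?N ^^ (Suc k - 1 - i)) x) *\<^sub>R (?N ^^ i) u) =
     (u \<bullet> (?N ^^ k) x) *\<^sub>R u + (\<Sum>i<k. (u \<bullet> (?N ^^ (k - 1 - i)) x) *\<^sub>R (?N ^^ Suc i) u)"
    by (simp add: sum.lessThan_Suc_shift del: sum.lessThan_Suc)
  ultimately show ?case by (simp only: minus_add_distrib diff_conv_add_uminus add.commute)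
qed

lemma moment_rank1_down_derivative:
  fixes f :: "'a::euclidean_space \<Rightarrow> 'a"
  assumes lin: "linear f"
  shows "((\<lambda>c. y \<bullet> (rank1_down f u c ^^ k) x) has_real_derivative
     (- (\<Sum>i<k. (u \<bullet> (rank1_down f u c ^^ (k - 1 - i)) x) * (y \<bullet> (rank1_down f u c ^^ i) u)))) (at c)"
  using bounded_linear.has_vector_derivative[OF bounded_linear_inner_right[of y]
      funpow_rank1_down_derivative[OF lin, where u = u and c = c and k = k and x = x]]
  by (simp add: has_real_derivative_iff_has_vector_derivative inner_sum_right)

text \<open>By cyclicity of the trace all \<open>k\<close> terms of the product rule coincide.
  Cyclicity here is self-adjointness followed by the expansion of an inner product in the
  basis.\<close>

lemma op_trace_rank1_down_derivative:
  fixes f :: "'a::euclidean_space \<Rightarrow> 'a"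
  assumes fb: "form_between lo hi f" and c: "0 \<le> c"
  shows "((\<lambda>c. op_trace (rank1_down f u c ^^ k)) has_real_derivative
     (- (real k * (u \<bullet> (rank1_down f u c ^^ (k - 1)) u)))) (at c)"
proof -
  let ?N = "rank1_down f u c"
  have lin: "linear f" using fb by (simp add: form_between_def)
  have sym: "?N x \<bullet> y = x \<bullet> ?N y" for x y
    using form_between_rank1_down[OF fb c, of u] by (simp add: form_between_def)
  have "((\<lambda>c. op_trace (rank1_down f u c ^^ k)) has_real_derivative
    (\<Sum>b\<in>Basis. - (\<Sum>i<k. (u \<bullet> (?N ^^ (k - 1 - i)) b) * (b \<bullet> (?N ^^ i) u)))) (at c)"
    unfolding op_trace_def by (intro DERIV_sum moment_rank1_down_derivative lin)
  moreover have "(\<Sum>b\<in>Basis. - (\<Sum>i<k. (u \<bullet> (?N ^^ (k - 1 - i)) b) * (b \<bullet> (?N ^^ i) u))) =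
    - (\<Sum>i<k. \<Sum>b\<in>Basis. ((?N ^^ (k - 1 - i)) u \<bullet> b) * ((?N ^^ i) u \<bullet> b))"
  proof -
    have "(u \<bullet> (?N ^^ (k - 1 - i)) b) * (b \<bullet> (?N ^^ i) u) =
      ((?N ^^ (k - 1 - i)) u \<bullet> b) * ((?N ^^ i) u \<bullet> b)" for b i
      by (simp add: symmetric_funpow[of ?N, OF sym] inner_commute[of b])
    then show ?thesis by (simp add: sum_negf sum.swap[of _ Basis])
  qed
  moreover have "(\<Sum>i<k. \<Sum>b\<in>Basis. ((?N ^^ (k - 1 - i)) u \<bullet> b) * ((?N ^^ i) u \<bullet> b)) =
     (\<Sum>i<k. u \<bullet> (?N ^^ (k - 1)) u)"
    by (intro sum.cong refl) (simp add: inner_funpow_add[of ?N, OF sym] flip: euclidean_inner)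
  ultimately show ?thesis by simp
qed

text \<open>
  Since \<open>exp (- \<theta> W)\<close> is the limit of \<open>(1 - \<theta> W / k) ^ k\<close>, this is the case of a rank-one
  summand of the Golden-Thompson inequality, before passing to the limit.  The derivative in \<open>c\<close>
  of the moment \<open>u \<bullet> N ^ (k - 1) u\<close> is minus a sum of products of two moments, which supermultiplicativity
  bounds by a multiple of the moment itself.
\<close>

lemma op_trace_rank1_down_unit:
  fixes f :: "'a::euclidean_space \<Rightarrow> 'a"
  assumes fb: "form_between lo hi f" and u: "norm u = 1" and c: "0 \<le> c"
    and m0: "0 < m0" "m0 \<le> lo - c" and hi: "0 < hi"
    and k: "k = Suc (Suc (2 * m))" and eta: "eta = real (k - 1) / m0"
  shows "op_trace (rank1_down f u c ^^ k) \<le>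
    op_trace (f ^^ k) - real k / (hi * eta) * (1 - exp (- (eta * c))) * (u \<bullet> (f ^^ k) u)"
proof -
  let ?N = "rank1_down f u"
  have lin: "linear f" using fb by (simp add: form_between_def)
  have eta_pos: "eta > 0" using k m0 by (simp add: eta)
  \<comment> \<open>A single positive lower bound makes the moment inequalities available along the
    whole path.\<close>
  have fbt: "form_between m0 hi (?N t)" if "0 \<le> t" "t \<le> c" for t
  proof -
    have "form_between (lo - t * (u \<bullet> u)) hi (?N t)"
      using form_between_rank1_down[OF fb \<open>0 \<le> t\<close>] .
    moreover have "m0 \<le> lo - t * (u \<bullet> u)" using u that m0 by (simp add: norm_eq_1)
    ultimately show ?thesis by (rule form_between_lower_mono)
  qed
  define g where "g t = u \<bullet> (?N t ^^ (k - 1)) u" for t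
  define g' where "g' t = - (\<Sum>i<k - 1. (u \<bullet> (?N t ^^ (k - 1 - 1 - i)) u) * (u \<bullet> (?N t ^^ i) u))" for t
  have dg: "(g has_real_derivative g' t) (at t)" for t
    unfolding g_def g'_def by (rule moment_rank1_down_derivative[OF lin])
  \<comment> \<open>The derivative has \<open>k - 1\<close> products, each at most the moment of
    order \<open>k - 2\<close>; raising the order by one costs a factor \<open>1 / m0\<close>. This
    is where \<open>eta\<close> comes from.\<close>
  have g'_ge: "- eta * g t \<le> g' t" if t: "0 \<le> t" "t \<le> c" for t
  proof -
    note N = fbt[OF t] m0(1)
    have "(\<Sum>i<k - 1. (u \<bullet> (?N t ^^ (k - 1 - 1 - i)) u) * (u \<bullet> (?N t ^^ i) u)) \<le>
      (\<Sum>i<k - 1. u \<bullet> (?N t ^^ (k - 2)) u)"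
    proof (rule sum_mono)
      fix i assume "i \<in> {..<k - 1}"
      then have "k - 1 - 1 - i + i = k - 2" by auto
      then show "(u \<bullet> (?N t ^^ (k - 1 - 1 - i)) u) * (u \<bullet> (?N t ^^ i) u) \<le> u \<bullet> (?N t ^^ (k - 2)) u"
        using moment_supermult[OF N u, of "k - 1 - 1 - i" i] by simp
    qed
    then have 1: "- g' t \<le> real (k - 1) * (u \<bullet> (?N t ^^ (k - 2)) u)" by (simp add: g'_def)
    have "m0 * (u \<bullet> (?N t ^^ (k - 2)) u) \<le> (u \<bullet> ?N t u) * (u \<bullet> (?N t ^^ (k - 2)) u)"
      using form_between_lower[OF N, of u] moment_pos[OF N u, of "k - 2"] u
      by (intro mult_right_mono) (auto simp: norm_eq_1)
    also have "\<dots> \<le> g t"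
      using moment_supermult[OF N u, of 1 "k - 2"] by (simp add: g_def k)
    finally have "u \<bullet> (?N t ^^ (k - 2)) u \<le> g t / m0" using m0 by (simp add: field_simps)
    then have "real (k - 1) * (u \<bullet> (?N t ^^ (k - 2)) u) \<le> real (k - 1) * (g t / m0)"
      by (rule mult_left_mono) simp
    with 1 show ?thesis by (simp add: eta)
  qed
  \<comment> \<open>Gronwall's argument with integrating factor
    \<open>exp (eta * t)\<close>.\<close>
  have g_ge: "exp (- (eta * t)) * g 0 \<le> g t" if t: "0 \<le> t" "t \<le> c" for t
  proof -
    have "exp (eta * 0) * g 0 \<le> exp (eta * t) * g t"
    proof (rule DERIV_nonneg_imp_nondecreasing[OF t(1)])
      fix x assume "0 \<le> x" "x \<le> t"
      then have "0 \<le> eta * g x + g' x" using g'_ge[of x] t by simp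
      then have "0 \<le> exp (eta * x) * (eta * g x + g' x)" by simp
      moreover have "((\<lambda>x. exp (eta * x) * g x) has_real_derivative
          exp (eta * x) * (eta * g x + g' x)) (at x)"
        by (rule derivative_eq_intros dg refl | simp add: algebra_simps)+
      ultimately show "\<exists>y. ((\<lambda>x. exp (eta * x) * g x) has_real_derivative y) (at x) \<and> 0 \<le> y"
        by blast
    qed
    then show ?thesis by (simp add: exp_minus field_simps)
  qed
  \<comment> \<open>The added term vanishes at 0 and has derivative
    \<open>real k * g 0 * exp (- (eta * t))\<close>, which is at most \<open>real k * g t\<close>,
    the rate at which the trace decreases.\<close>
  define F where "F t = op_trace (?N t ^^ k) + real k * g 0 * (1 - exp (- (eta * t))) / eta" for t
  have "F c \<le> F 0"
  proof (rule DERIV_nonpos_imp_nonincreasing[OF c])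
    fix t assume t: "0 \<le> t" "t \<le> c"
    have d: "((\<lambda>t. op_trace (?N t ^^ k)) has_real_derivative - (real k * g t)) (at t)"
      unfolding g_def by (rule op_trace_rank1_down_derivative[OF fb t(1)])
    have "(F has_real_derivative - (real k * g t) + real k * g 0 * exp (- (eta * t))) (at t)"
      unfolding F_def using eta_pos
      by (auto intro!: derivative_eq_intros d)
    moreover have "- (real k * g t) + real k * g 0 * exp (- (eta * t)) \<le> 0"
      using mult_left_mono[OF g_ge[OF t], of "real k"] by (simp add: mult_ac)
    ultimately show "\<exists>y. (F has_real_derivative y) (at t) \<and> y \<le> 0" by blast
  qed
  then have 2: "op_trace (?N c ^^ k) \<le> op_trace (f ^^ k) - real k * g 0 * (1 - exp (- (eta * c))) / eta"
    by (simp add: F_def)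
  have fb0: "form_between m0 hi f" using fbt[of 0] c by simp
  \<comment> \<open>The order \<open>k - 1\<close> is odd, so it can be raised to \<open>k\<close>
    at the price of \<open>hi\<close>. Averaging will then reproduce the trace of the same power
    \<open>f ^^ k\<close>.\<close>
  have "u \<bullet> (f ^^ k) u \<le> hi * g 0"
    using moment_le_upper[OF fb0 m0(1), of u m] by (simp add: g_def k)
  then have "(u \<bullet> (f ^^ k) u) / hi \<le> g 0" using hi by (simp add: field_simps)
  moreover have "0 \<le> real k * (1 - exp (- (eta * c))) / eta" using eta_pos c by simp
  ultimately have "real k * (1 - exp (- (eta * c))) / eta * ((u \<bullet> (f ^^ k) u) / hi) \<le>
     real k * (1 - exp (- (eta * c))) / eta * g 0"
    by (rule mult_left_mono)
  with 2 show ?thesis by (simp add: mult_ac)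
qed

text \<open>A concave function lies above its chord. The chord is linear in \<open>c\<close>, so it
  can be averaged over samples of different lengths.\<close>

lemma one_minus_exp_chord:
  fixes a c R :: real
  assumes "0 < a" "0 \<le> c" "c \<le> R" "0 < R"
  shows "c / R * (1 - exp (- (a * R))) \<le> 1 - exp (- (a * c))"
proof -
  have "convex_on UNIV (exp :: real \<Rightarrow> real)" by (rule exp_convex)
  from convex_onD[OF this, of "c / R" 0 "- (a * R)"] assms
  have "exp (- (a * c)) \<le> (1 - c / R) * 1 + c / R * exp (- (a * R))" by (simp add: mult.commute)
  then show ?thesis by (simp add: algebra_simps)
qed

text \<open>Write \<open>x\<close> as its length times a unit vector. The chord bound then makes the
  decrease proportional to a quadratic form in \<open>x\<close>, whose mean is fixed by
  isotropy.\<close>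

lemma op_trace_rank1_down:
  fixes f :: "'a::euclidean_space \<Rightarrow> 'a"
  assumes fb: "form_between lo hi f" and x: "x \<bullet> x \<le> R" and R: "0 < R"
    and m0: "0 < m0" "m0 \<le> lo - R" and hi: "0 < hi"
    and k: "k = Suc (Suc (2 * m))" and eta: "eta = real (k - 1) / m0"
  shows "op_trace (rank1_down f x 1 ^^ k) \<le>
    op_trace (f ^^ k) - real k / (hi * eta) * ((1 - exp (- (eta * R))) / R) * (x \<bullet> (f ^^ k) x)"
proof (cases "x = 0")
  case True
  then have "rank1_down f x 1 = f" by (simp add: rank1_down_def)
  with True show ?thesis by simp
next
  case False
  define u c where "u = sgn x" and "c = x \<bullet> x"
  have u: "norm u = 1" using False by (simp add: u_def norm_sgn)
  have c: "0 \<le> c" "c \<le> R" using x by (auto simp: c_def)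
  have xu: "x = norm x *\<^sub>R u" using False by (simp add: u_def sgn_div_norm)
  have cn: "c = (norm x)\<^sup>2" by (simp add: c_def power2_norm_eq_inner)
  have r: "rank1_down f x 1 = rank1_down f u c"
    unfolding rank1_down_def cn by (subst (1 2) xu) (simp add: power2_eq_square mult_ac)
  have lin: "linear (f ^^ k)" using fb by (auto simp: form_between_def intro: linear_funpow)
  have q: "x \<bullet> (f ^^ k) x = c * (u \<bullet> (f ^^ k) u)"
    unfolding cn by (subst (1 2) xu) (simp add: linear_scale[OF lin] power2_eq_square)
  have fb': "form_between m0 hi f"
    using fb by (rule form_between_lower_mono) (use m0 R in simp)
  have eta_pos: "eta > 0" using k m0 by (simp add: eta)
  have "op_trace (rank1_down f u c ^^ k) \<le>
    op_trace (f ^^ k) - real k / (hi * eta) * (1 - exp (- (eta * c))) * (u \<bullet> (f ^^ k) u)"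
    using c m0 by (intro op_trace_rank1_down_unit[OF fb u c(1) m0(1) _ hi k eta]) simp
  moreover have "real k / (hi * eta) * (c / R * (1 - exp (- (eta * R)))) * (u \<bullet> (f ^^ k) u) \<le>
      real k / (hi * eta) * (1 - exp (- (eta * c))) * (u \<bullet> (f ^^ k) u)"
    using one_minus_exp_chord[OF eta_pos c R] moment_pos[OF fb' m0(1) u, of k] hi eta_pos
    by (intro mult_right_mono mult_left_mono) auto
  ultimately show ?thesis unfolding r q by (simp add: mult_ac)
qed

subsection \<open>A Chernoff bound for sums of random rank-one operators\<close>

lemma finite_set_Pi_pmf:
  fixes q :: "'n::finite pmf"
  assumes "finite I"
  shows "finite (set_pmf (Pi_pmf I d (\<lambda>_. q)))"
  by (rule finite_subset[OF set_Pi_pmf_subset'[OF assms]]) (intro finite_PiE_dflt assms finite)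

lemma integrable_Pi_pmf_finite:
  fixes q :: "'n::finite pmf" and F :: "('i \<Rightarrow> 'n) \<Rightarrow> real"
  assumes "finite I"
  shows "integrable (measure_pmf (Pi_pmf I d (\<lambda>_. q))) F"
  by (intro integrable_measure_pmf_finite finite_set_Pi_pmf assms)

text \<open>Independence enters here: the last draw is integrated out with the earlier ones held
  fixed. Both inductions on the number of samples rest on this.\<close>

lemma expectation_Pi_pmf_Suc:
  fixes q :: "'n::finite pmf" and F :: "(nat \<Rightarrow> 'n) \<Rightarrow> real"
  shows "measure_pmf.expectation (Pi_pmf {..<Suc j} d (\<lambda>_. q)) F =
    measure_pmf.expectation (Pi_pmf {..<j} d (\<lambda>_. q)) (\<lambda>\<xi>. \<Sum>i\<in>UNIV. pmf q i * F (\<xi>(j := i)))"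
proof -
  let ?P = "Pi_pmf {..<j} d (\<lambda>_. q)"
  have "Pi_pmf {..<Suc j} d (\<lambda>_. q) = q \<bind> (\<lambda>i. map_pmf (\<lambda>\<xi>. \<xi>(j := i)) ?P)"
    unfolding lessThan_Suc by (subst Pi_pmf_insert') (simp_all add: map_pmf_def)
  then have "measure_pmf.expectation (Pi_pmf {..<Suc j} d (\<lambda>_. q)) F =
    (\<Sum>i\<in>UNIV. pmf q i *\<^sub>R measure_pmf.expectation (map_pmf (\<lambda>\<xi>. \<xi>(j := i)) ?P) F)"
    by (simp add: pmf_expectation_bind[of UNIV] finite_set_Pi_pmf)
  also have "\<dots> = measure_pmf.expectation ?P (\<lambda>\<xi>. \<Sum>i\<in>UNIV. pmf q i * F (\<xi>(j := i)))"
    by (subst Bochner_Integration.integral_sum)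
       (simp_all add: integrable_Pi_pmf_finite)
  finally show ?thesis .
qed

lemma expectation_Pi_pmf_mono:
  fixes q :: "'n::finite pmf" and F G :: "(nat \<Rightarrow> 'n) \<Rightarrow> real"
  assumes "\<And>\<xi>. F \<xi> \<le> G \<xi>"
  shows "measure_pmf.expectation (Pi_pmf {..<j} d (\<lambda>_. q)) F \<le>
     measure_pmf.expectation (Pi_pmf {..<j} d (\<lambda>_. q)) G"
  by (intro integral_mono integrable_Pi_pmf_finite assms) auto

lemma Markov_Pi_pmf:
  fixes q :: "'n::finite pmf" and F :: "(nat \<Rightarrow> 'n) \<Rightarrow> real"
  assumes "\<And>\<xi>. 0 \<le> F \<xi>" and "0 < a" and "\<And>\<xi>. \<xi> \<in> E \<Longrightarrow> a \<le> F \<xi>"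
  shows "measure_pmf.prob (Pi_pmf {..<j} d (\<lambda>_. q)) E \<le>
     measure_pmf.expectation (Pi_pmf {..<j} d (\<lambda>_. q)) F / a"
proof -
  let ?P = "Pi_pmf {..<j} d (\<lambda>_. q)"
  have "measure_pmf.prob ?P E \<le> measure_pmf.prob ?P {\<xi>. a \<le> F \<xi>}"
    using assms(3) by (intro measure_pmf.finite_measure_mono) auto
  also have "\<dots> \<le> measure_pmf.expectation ?P F / a"
    using integral_Markov_inequality_measure[OF integrable_Pi_pmf_finite[of "{..<j}" d q F], of UNIV a] assms
    by simp
  finally show ?thesis .
qed

text \<open>The shift \<open>b\<close> minus the sum of the first \<open>j\<close> rank-one samples.
  A small eigenvalue of the sampled sum becomes a large one of this operator, where the trace of a
  power can detect it.\<close>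

definition sample_residual ::
    "real \<Rightarrow> ('n \<Rightarrow> 'a::euclidean_space) \<Rightarrow> nat \<Rightarrow> (nat \<Rightarrow> 'n) \<Rightarrow> 'a \<Rightarrow> 'a" where
  "sample_residual b x j \<xi> y = b *\<^sub>R y - (\<Sum>l<j. (x (\<xi> l) \<bullet> y) *\<^sub>R x (\<xi> l))"

lemma sample_residual_Suc:
  "sample_residual b x (Suc j) (\<xi>(j := i)) = rank1_down (sample_residual b x j \<xi>) (x i) 1"
  by (simp add: fun_eq_iff sample_residual_def rank1_down_def)

lemma form_between_sample_residual:
  fixes x :: "'n \<Rightarrow> 'a::euclidean_space"
  assumes "\<And>i. x i \<bullet> x i \<le> R"
  shows "form_between (b - real j * R) b (sample_residual b x j \<xi>)"
proof (induction j)
  case 0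
  have "sample_residual b x 0 \<xi> = (\<lambda>y. b *\<^sub>R y)" by (simp add: fun_eq_iff sample_residual_def)
  then show ?case by (simp add: form_between_def linear_iff scaleR_add_right)
next
  case (Suc j)
  have "sample_residual b x (Suc j) \<xi> = rank1_down (sample_residual b x j \<xi>) (x (\<xi> j)) 1"
    using sample_residual_Suc[of b x j \<xi> "\<xi> j"] by simp
  then have "form_between (b - real j * R - 1 * (x (\<xi> j) \<bullet> x (\<xi> j))) b (sample_residual b x (Suc j) \<xi>)"
    using form_between_rank1_down[OF Suc, of 1 "x (\<xi> j)"] by simp
  then show ?case
    by (rule form_between_lower_mono) (use assms[of "\<xi> j"] in \<open>simp add: algebra_simps\<close>)
qed

text \<open>The hypothesis \<open>iso\<close> says that the weighted sum of the rank-one operators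
  of the \<open>x i\<close> is the identity divided by \<open>s\<close>; expanding
  \<open>f (x i)\<close> in the basis reduces the claim to it.\<close>

lemma isotropic_quadratic_trace:
  fixes x :: "'n::finite \<Rightarrow> 'a::euclidean_space"
  assumes lin: "linear f" and iso: "\<And>y z. (\<Sum>i\<in>UNIV. w i * ((x i \<bullet> y) * (x i \<bullet> z))) = (y \<bullet> z) / s"
  shows "(\<Sum>i\<in>UNIV. w i * (x i \<bullet> f (x i))) = op_trace f / s"
proof -
  have "x i \<bullet> f (x i) = (\<Sum>b\<in>Basis. (x i \<bullet> b) * (x i \<bullet> f b))" for i
  proof -
    have "f (x i) = f (\<Sum>b\<in>Basis. (x i \<bullet> b) *\<^sub>R b)" by (simp only: euclidean_representation)
    also have "\<dots> = (\<Sum>b\<in>Basis. (x i \<bullet> b) *\<^sub>R f b)"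
      by (simp add: linear_sum[OF lin] linear_scale[OF lin])
    finally show ?thesis by (simp add: inner_sum_right)
  qed
  then have "(\<Sum>i\<in>UNIV. w i * (x i \<bullet> f (x i))) =
     (\<Sum>b\<in>Basis. \<Sum>i\<in>UNIV. w i * ((x i \<bullet> b) * (x i \<bullet> f b)))"
    by (subst sum.swap) (simp add: sum_distrib_left)
  then show ?thesis by (simp add: iso op_trace_def sum_divide_distrib)
qed

text \<open>Conditionally on the past, each draw multiplies the trace by at most
  \<open>1 - \<kappa> / s\<close>, hence by at most \<open>exp (- (\<kappa> / s))\<close>. The
  initial trace is that of \<open>b\<close> times the identity, raised to the power
  \<open>k\<close>.\<close>

lemma expectation_op_trace_sample_residual:
  fixes x :: "'n::finite \<Rightarrow> 'a::euclidean_space" and q :: "'n pmf" and s :: nat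
  assumes x: "\<And>i. x i \<bullet> x i \<le> R" and R: "0 < R" and s: "0 < s"
    and iso: "\<And>y z. (\<Sum>i\<in>UNIV. pmf q i * ((x i \<bullet> y) * (x i \<bullet> z))) = (y \<bullet> z) / real s"
    and m0: "0 < m0" "m0 = b - real s * R"
    and k: "k = Suc (Suc (2 * m))" and eta: "eta = real (k - 1) / m0"
  shows "measure_pmf.expectation (Pi_pmf {..<s} d (\<lambda>_. q)) (\<lambda>\<xi>. op_trace (sample_residual b x s \<xi> ^^ k))
     \<le> real DIM('a) * b ^ k * exp (- (real k / (b * eta) * ((1 - exp (- (eta * R))) / R)))"
proof -
  define \<kappa> where "\<kappa> = real k / (b * eta) * ((1 - exp (- (eta * R))) / R)"
  let ?\<Phi> = "\<lambda>j \<xi>. op_trace (sample_residual b x j \<xi> ^^ k)"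
  let ?E = "\<lambda>j. measure_pmf.expectation (Pi_pmf {..<j} d (\<lambda>_. q))"
  have b: "0 < b" using m0 R s by (smt (verit) mult_pos_pos of_nat_0_less_iff)
  have step: "(\<Sum>i\<in>UNIV. pmf q i * ?\<Phi> (Suc j) (\<xi>(j := i))) \<le> exp (- (\<kappa> / s)) * ?\<Phi> j \<xi>"
    if j: "j < s" for j \<xi>
  proof -
    let ?N = "sample_residual b x j \<xi>"
    note fb = form_between_sample_residual[of x R b j \<xi>, OF x]
    \<comment> \<open>\<open>m0\<close> is the lower bound after all \<open>s\<close> draws, so it
      remains valid at every earlier one and \<open>\<kappa>\<close> does not depend on
      \<open>j\<close>.\<close>
    have jR: "real j * R + R \<le> real s * R"
    proof -
      have "real (Suc j) * R \<le> real s * R" using j R by (intro mult_right_mono) auto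
      then show ?thesis by (simp add: algebra_simps)
    qed
    then have mj: "m0 \<le> b - real j * R - R" using m0 by simp
    have pos: "0 < b - real j * R" using mj m0 R by linarith
    have lin: "linear (?N ^^ k)" using fb by (auto simp: form_between_def intro: linear_funpow)
    have "(\<Sum>i\<in>UNIV. pmf q i * ?\<Phi> (Suc j) (\<xi>(j := i))) \<le>
      (\<Sum>i\<in>UNIV. pmf q i * (?\<Phi> j \<xi> - \<kappa> * (x i \<bullet> (?N ^^ k) (x i))))"
      unfolding \<kappa>_def sample_residual_Suc
      by (intro sum_mono mult_left_mono op_trace_rank1_down[OF fb x R m0(1) mj b k eta]) auto
    also have "\<dots> = (\<Sum>i\<in>UNIV. pmf q i) * ?\<Phi> j \<xi> - \<kappa> * (\<Sum>i\<in>UNIV. pmf q i * (x i \<bullet> (?N ^^ k) (x i)))"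
      by (simp add: right_diff_distrib sum_subtractf sum_distrib_left sum_distrib_right mult_ac)
    also have "\<dots> = (1 - \<kappa> / s) * ?\<Phi> j \<xi>"
      by (simp add: isotropic_quadratic_trace[OF lin iso] sum_pmf_eq_1 algebra_simps)
    also have "\<dots> \<le> exp (- (\<kappa> / s)) * ?\<Phi> j \<xi>"
      using exp_ge_add_one_self[of "- (\<kappa> / s)"]
      by (intro mult_right_mono op_trace_funpow_nonneg[OF fb pos]) simp
    finally show ?thesis .
  qed
  have "?E j (?\<Phi> j) \<le> exp (- (\<kappa> / s)) ^ j * (real DIM('a) * b ^ k)" if "j \<le> s" for j
    using that
  proof (induction j)
    case 0
    have "(sample_residual b x 0 \<xi> ^^ n) y = b ^ n *\<^sub>R y" for \<xi> n y
      by (induction n) (simp_all add: sample_residual_def)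
    then show ?case by (simp add: op_trace_def)
  next
    case (Suc j)
    have "?E (Suc j) (?\<Phi> (Suc j)) \<le> ?E j (\<lambda>\<xi>. exp (- (\<kappa> / s)) * ?\<Phi> j \<xi>)"
      unfolding expectation_Pi_pmf_Suc using step Suc.prems by (intro expectation_Pi_pmf_mono) auto
    also have "\<dots> = exp (- (\<kappa> / s)) * ?E j (?\<Phi> j)" by simp
    also have "\<dots> \<le> exp (- (\<kappa> / s)) * (exp (- (\<kappa> / s)) ^ j * (real DIM('a) * b ^ k))"
      using Suc by (intro mult_left_mono) auto
    finally show ?case by (simp add: mult_ac)
  qed
  from this[of s] have "?E s (?\<Phi> s) \<le> exp (- (\<kappa> / s)) ^ s * (real DIM('a) * b ^ k)" by simp
  moreover have "exp (- (\<kappa> / s)) ^ s = exp (- \<kappa>)" using s by (simp flip: exp_of_nat_mult)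
  ultimately show ?thesis by (simp add: \<kappa>_def mult_ac)
qed

text \<open>On the bad event a unit vector has residual form at least \<open>b - \<tau>\<close>.
  Jensen passes this to the moment of order \<open>k\<close>, the trace dominates that moment, and
  Markov's inequality applies.\<close>

lemma rank1_Chernoff_finite:
  fixes x :: "'n::finite \<Rightarrow> 'a::euclidean_space" and q :: "'n pmf" and s :: nat
  assumes x: "\<And>i. x i \<bullet> x i \<le> R" and R: "0 < R" and s: "0 < s"
    and iso: "\<And>y z. (\<Sum>i\<in>UNIV. pmf q i * ((x i \<bullet> y) * (x i \<bullet> z))) = (y \<bullet> z) / real s"
    and m0: "0 < m0" "m0 = b - real s * R" and \<tau>: "\<tau> < b"
    and k: "k = Suc (Suc (2 * m))" and eta: "eta = real (k - 1) / m0"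
  shows "measure_pmf.prob (Pi_pmf {..<s} d (\<lambda>_. q))
       {\<xi>. \<exists>y. (\<Sum>l<s. (x (\<xi> l) \<bullet> y)\<^sup>2) < \<tau> * (y \<bullet> y)}
     \<le> real DIM('a) * b ^ k * exp (- (real k / (b * eta) * ((1 - exp (- (eta * R))) / R))) / (b - \<tau>) ^ k"
proof -
  have *: "(b - \<tau>) ^ k \<le> op_trace (sample_residual b x s \<xi> ^^ k)"
    if y: "(\<Sum>l<s. (x (\<xi> l) \<bullet> y)\<^sup>2) < \<tau> * (y \<bullet> y)" for \<xi> y
  proof -
    let ?N = "sample_residual b x s \<xi>"
    have fb: "form_between m0 b ?N" using form_between_sample_residual[of x R b s \<xi>, OF x] m0(2) by simp
    define v where "v = sgn y"
    have "y \<noteq> 0" using y by auto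
    then have v: "norm v = 1" and yv: "y = norm y *\<^sub>R v"
      by (simp_all add: v_def norm_sgn sgn_div_norm)
    have "(norm y)\<^sup>2 * (\<Sum>l<s. (x (\<xi> l) \<bullet> v)\<^sup>2) < (norm y)\<^sup>2 * \<tau>"
    proof -
      have "(x (\<xi> l) \<bullet> y)\<^sup>2 = (norm y)\<^sup>2 * (x (\<xi> l) \<bullet> v)\<^sup>2" for l
        by (subst yv) (simp add: power_mult_distrib)
      then have "(\<Sum>l<s. (x (\<xi> l) \<bullet> y)\<^sup>2) = (norm y)\<^sup>2 * (\<Sum>l<s. (x (\<xi> l) \<bullet> v)\<^sup>2)"
        by (simp add: sum_distrib_left)
      with y show ?thesis by (simp add: power2_norm_eq_inner mult.commute)
    qed
    then have "(\<Sum>l<s. (x (\<xi> l) \<bullet> v)\<^sup>2) < \<tau>" using \<open>y \<noteq> 0\<close> by simp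
    moreover have "v \<bullet> ?N v = b - (\<Sum>l<s. (x (\<xi> l) \<bullet> v)\<^sup>2)"
      using v by (simp add: sample_residual_def inner_diff_right inner_sum_right power2_eq_square
          inner_commute norm_eq_1)
    ultimately have "b - \<tau> \<le> v \<bullet> ?N v" by simp
    then have "(b - \<tau>) ^ k \<le> (v \<bullet> ?N v) ^ k" using \<tau> by (intro power_mono) auto
    also have "\<dots> \<le> v \<bullet> (?N ^^ k) v" by (rule moment_power_le[OF fb m0(1) v])
    also have "\<dots> \<le> op_trace (?N ^^ k)"
      using moment_le_op_trace[OF fb m0(1) v, of "Suc m"] by (simp add: k)
    finally show ?thesis .
  qed
  have "measure_pmf.prob (Pi_pmf {..<s} d (\<lambda>_. q))
       {\<xi>. \<exists>y. (\<Sum>l<s. (x (\<xi> l) \<bullet> y)\<^sup>2) < \<tau> * (y \<bullet> y)} \<le>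
     measure_pmf.expectation (Pi_pmf {..<s} d (\<lambda>_. q)) (\<lambda>\<xi>. op_trace (sample_residual b x s \<xi> ^^ k)) / (b - \<tau>) ^ k"
  proof (rule Markov_Pi_pmf)
    fix \<xi>
    have fb: "form_between m0 b (sample_residual b x s \<xi>)"
      using form_between_sample_residual[of x R b s \<xi>, OF x] m0(2) by simp
    show "0 \<le> op_trace (sample_residual b x s \<xi> ^^ k)"
      by (rule op_trace_funpow_nonneg[OF fb m0(1)])
  qed (use * \<tau> in auto)
  also have "\<dots> \<le> real DIM('a) * b ^ k * exp (- (real k / (b * eta) * ((1 - exp (- (eta * R))) / R))) / (b - \<tau>) ^ k"
    using \<tau> by (intro divide_right_mono expectation_op_trace_sample_residual[OF x R s iso m0 k eta]) auto
  finally show ?thesis .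
qed

text \<open>The finite bound is taken along even \<open>k\<close> with
  \<open>b = k / \<theta>\<close>. As \<open>k\<close> grows, \<open>eta\<close> tends to
  \<open>\<theta>\<close> and the quotient of the powers of \<open>b\<close> and
  \<open>b - \<tau>\<close> tends to \<open>exp (\<theta> * \<tau>)\<close>, so the probability,
  which is free of \<open>k\<close>, is bounded by the limit.\<close>

lemma rank1_Chernoff:
  fixes x :: "'n::finite \<Rightarrow> 'a::euclidean_space" and q :: "'n pmf" and s :: nat
  assumes x: "\<And>i. x i \<bullet> x i \<le> R" and R: "0 < R" and s: "0 < s"
    and iso: "\<And>y z. (\<Sum>i\<in>UNIV. pmf q i * ((x i \<bullet> y) * (x i \<bullet> z))) = (y \<bullet> z) / real s"
    and \<tau>: "0 < \<tau>" "\<tau> < 1"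
  shows "measure_pmf.prob (Pi_pmf {..<s} d (\<lambda>_. q))
       {\<xi>. \<exists>y. (\<Sum>l<s. (x (\<xi> l) \<bullet> y)\<^sup>2) < \<tau> * (y \<bullet> y)}
     \<le> real DIM('a) * exp (- ((1 - \<tau> + \<tau> * ln \<tau>) / R))"
proof -
  \<comment> \<open>the minimiser of the exponent \<open>\<theta> * \<tau> - (1 - exp (- \<theta> * R)) / R\<close> obtained in the limit\<close>
  define \<theta> where "\<theta> = - ln \<tau> / R"
  have \<theta>: "\<theta> > 0" using \<tau> R by (simp add: \<theta>_def divide_less_0_iff)
  let ?P = "measure_pmf.prob (Pi_pmf {..<s} d (\<lambda>_. q))
       {\<xi>. \<exists>y. (\<Sum>l<s. (x (\<xi> l) \<bullet> y)\<^sup>2) < \<tau> * (y \<bullet> y)}"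
  define k b eta where "k m = Suc (Suc (2 * m))" and "b m = real (k m) / \<theta>"
    and "eta m = real (k m - 1) / (b m - real s * R)" for m
  have b_lim: "filterlim b at_top at_top"
    unfolding b_def k_def using \<theta> by real_asymp
  have eta_lim: "eta \<longlonglongrightarrow> \<theta>"
  proof -
    have "(\<lambda>m. real (Suc (2 * m)) / (real (Suc (Suc (2 * m))) / \<theta> - real s * R)) \<longlonglongrightarrow> \<theta>"
      using \<theta> by real_asymp
    then show ?thesis unfolding eta_def b_def k_def by simp
  qed
  have pow_lim: "(\<lambda>m. (1 - \<tau> / b m) ^ k m) \<longlonglongrightarrow> exp (- (\<theta> * \<tau>))"
  proof -
    have "(\<lambda>n. (1 + (- (\<theta> * \<tau>)) / real n) ^ n) \<longlonglongrightarrow> exp (- (\<theta> * \<tau>))"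
      by (rule tendsto_exp_limit_sequentially)
    moreover have "filterlim k at_top at_top"
      unfolding k_def by (intro filterlim_subseq) (simp add: strict_mono_def)
    ultimately have "(\<lambda>m. (1 + (- (\<theta> * \<tau>)) / real (k m)) ^ k m) \<longlonglongrightarrow> exp (- (\<theta> * \<tau>))"
      by (rule filterlim_compose)
    then show ?thesis by (simp add: b_def mult.commute)
  qed
  have "(\<lambda>m. real DIM('a) * exp (- (\<theta> / eta m * ((1 - exp (- (eta m * R))) / R))) / (1 - \<tau> / b m) ^ k m)
    \<longlonglongrightarrow> real DIM('a) * exp (- (\<theta> / \<theta> * ((1 - exp (- (\<theta> * R))) / R))) / exp (- (\<theta> * \<tau>))"
    using \<theta> R by (intro tendsto_intros eta_lim pow_lim) auto
  moreover have "eventually (\<lambda>m. ?P \<le>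
      real DIM('a) * exp (- (\<theta> / eta m * ((1 - exp (- (eta m * R))) / R))) / (1 - \<tau> / b m) ^ k m) sequentially"
    \<comment> \<open>The finite bound requires \<open>b\<close> to exceed both
      \<open>\<tau>\<close> and \<open>real s * R\<close>, which holds once \<open>k\<close> is
      large.\<close>
    using eventually_compose_filterlim[OF eventually_gt_at_top[of "max \<tau> (real s * R)"] b_lim]
  proof eventually_elim
    case (elim m)
    then have m: "0 < b m - real s * R" "\<tau> < b m" "0 < b m" using \<tau> by auto
    have "?P \<le> real DIM('a) * b m ^ k m * exp (- (real (k m) / (b m * eta m) *
        ((1 - exp (- (eta m * R))) / R))) / (b m - \<tau>) ^ k m"
      by (rule rank1_Chernoff_finite[OF x R s iso m(1) refl m(2) k_def[of m] eta_def[of m]])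
    also have "real (k m) / (b m * eta m) = \<theta> / eta m"
      using \<theta> by (simp add: b_def k_def)
    also have "1 - \<tau> / b m = (b m - \<tau>) / b m" using m by (simp add: field_simps)
    then have "real DIM('a) * b m ^ k m * exp (- (\<theta> / eta m * ((1 - exp (- (eta m * R))) / R))) / (b m - \<tau>) ^ k m =
       real DIM('a) * exp (- (\<theta> / eta m * ((1 - exp (- (eta m * R))) / R))) / (1 - \<tau> / b m) ^ k m"
      using m by (simp add: power_divide)
    finally show ?case .
  qed
  ultimately have "?P \<le> real DIM('a) * exp (- (\<theta> / \<theta> * ((1 - exp (- (\<theta> * R))) / R))) / exp (- (\<theta> * \<tau>))"
    by (rule tendsto_lowerbound) simp
  also have "exp (- (\<theta> * R)) = \<tau>" using R \<tau> by (simp add: \<theta>_def)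
  also have "real DIM('a) * exp (- (\<theta> / \<theta> * ((1 - \<tau>) / R))) / exp (- (\<theta> * \<tau>)) =
      real DIM('a) * exp (- ((1 - \<tau> + \<tau> * ln \<tau>) / R))"
  proof -
    have 1: "\<theta> / \<theta> * ((1 - \<tau>) / R) = (1 - \<tau>) / R" using \<theta> by simp
    have 2: "- ((1 - \<tau> + \<tau> * ln \<tau>) / R) = - ((1 - \<tau>) / R) - (- (\<theta> * \<tau>))"
      by (simp add: \<theta>_def add_divide_distrib mult.commute)
    show ?thesis unfolding 1 2 exp_diff by simp
  qed
  finally show ?thesis .
qed

subsection \<open>Second moments and least squares\<close>

text \<open>Given the earlier draws, the cross term is linear in the last summand and averages to
  zero.\<close>

lemma expectation_norm_sum_squared:
  fixes z :: "'n::finite \<Rightarrow> 'b::euclidean_space" and q :: "'n pmf"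
  assumes mean: "(\<Sum>i\<in>UNIV. pmf q i *\<^sub>R z i) = 0"
  shows "measure_pmf.expectation (Pi_pmf {..<j} d (\<lambda>_. q)) (\<lambda>\<xi>. (norm (\<Sum>l<j. z (\<xi> l)))\<^sup>2) =
    real j * (\<Sum>i\<in>UNIV. pmf q i * (norm (z i))\<^sup>2)"
proof (induction j)
  case (Suc j)
  define V where "V = (\<Sum>i\<in>UNIV. pmf q i * (norm (z i))\<^sup>2)"
  have "(\<Sum>i\<in>UNIV. pmf q i * (norm (\<Sum>l<Suc j. z ((\<xi>(j := i)) l)))\<^sup>2) = (norm (\<Sum>l<j. z (\<xi> l)))\<^sup>2 + V" for \<xi>
  proof -
    define t where "t = (\<Sum>l<j. z (\<xi> l))"
    have "(\<Sum>i\<in>UNIV. pmf q i * (norm (\<Sum>l<Suc j. z ((\<xi>(j := i)) l)))\<^sup>2) =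
      (\<Sum>i\<in>UNIV. pmf q i * (norm (t + z i))\<^sup>2)"
      by (simp add: t_def)
    also have "\<dots> = (\<Sum>i\<in>UNIV. pmf q i) * (norm t)\<^sup>2 + 2 * (t \<bullet> (\<Sum>i\<in>UNIV. pmf q i *\<^sub>R z i)) + V"
      by (simp add: V_def power2_norm_eq_inner inner_simps inner_sum_right inner_commute algebra_simps
         sum.distrib sum_distrib_left sum_distrib_right)
    finally show ?thesis by (simp add: mean sum_pmf_eq_1 t_def)
  qed
  then show ?case
    unfolding expectation_Pi_pmf_Suc
    by (simp add: Suc integrable_Pi_pmf_finite algebra_simps flip: V_def)
qed simp

lemma quadratic_nonneg_imp_linear_zero:
  fixes a c :: real
  assumes "\<And>t. 0 \<le> 2 * t * a + t\<^sup>2 * c"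
  shows "a = 0"
proof (rule ccontr)
  assume a: "a \<noteq> 0"
  \<comment> \<open>Any positive \<open>d\<close> with \<open>c < 2 * d\<close> would make
    \<open>t = - a / d\<close> a counterexample; this one works for either sign of
    \<open>c\<close>.\<close>
  define d where "d = \<bar>c\<bar> + 1"
  have d: "d > 0" "c < d" by (auto simp: d_def)
  have "0 \<le> 2 * (- a / d) * a + (- a / d)\<^sup>2 * c" by (rule assms)
  also have "\<dots> = (a / d)\<^sup>2 * (c - 2 * d)" using d by (simp add: field_simps power2_eq_square)
  also have "\<dots> < 0" using a d by (intro mult_pos_neg) auto
  finally show False by simp
qed

text \<open>Along the line through the minimiser in direction \<open>D\<close> the objective is
  quadratic in \<open>t\<close>, so its linear coefficient vanishes. The indexed family covers both
  problems: a single index for the full one, one index per drawn row for the sketched one.\<close>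

lemma least_squares_normal_equation:
  fixes L :: "'i \<Rightarrow> 'a::real_vector \<Rightarrow> 'b::real_inner"
  assumes L: "\<And>l. linear (L l)"
    and min: "is_arg_min (\<lambda>X. \<Sum>l\<in>I. (norm (L l X - b l))\<^sup>2) (\<lambda>_. True) X"
  shows "(\<Sum>l\<in>I. (L l X - b l) \<bullet> L l D) = 0"
proof (rule quadratic_nonneg_imp_linear_zero)
  fix t :: real
  have "(\<Sum>l\<in>I. (norm (L l X - b l))\<^sup>2) \<le> (\<Sum>l\<in>I. (norm (L l (X + t *\<^sub>R D) - b l))\<^sup>2)"
    using min by (simp add: is_arg_min_linorder)
  also have "\<dots> = (\<Sum>l\<in>I. (norm (L l X - b l))\<^sup>2 +
      (2 * t * ((L l X - b l) \<bullet> L l D) + t\<^sup>2 * (L l D \<bullet> L l D)))"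
  proof (rule sum.cong[OF refl])
    fix l
    have e: "L l (X + t *\<^sub>R D) - b l = (L l X - b l) + t *\<^sub>R L l D"
      by (simp add: linear_add[OF L] linear_scale[OF L])
    show "(norm (L l (X + t *\<^sub>R D) - b l))\<^sup>2 = (norm (L l X - b l))\<^sup>2 +
      (2 * t * ((L l X - b l) \<bullet> L l D) + t\<^sup>2 * (L l D \<bullet> L l D))"
      unfolding e using dot_norm[of "L l X - b l" "t *\<^sub>R L l D"]
      by (simp add: power_mult_distrib power2_norm_eq_inner[of "L l D"])
  qed
  also have "\<dots> = (\<Sum>l\<in>I. (norm (L l X - b l))\<^sup>2) +
      (2 * t * (\<Sum>l\<in>I. (L l X - b l) \<bullet> L l D) + t\<^sup>2 * (\<Sum>l\<in>I. L l D \<bullet> L l D))"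
    by (simp add: sum.distrib sum_distrib_left)
  finally show "0 \<le> 2 * t * (\<Sum>l\<in>I. (L l X - b l) \<bullet> L l D) + t\<^sup>2 * (\<Sum>l\<in>I. L l D \<bullet> L l D)"
    by simp
qed

section \<open>Row and column identities for matrices\<close>

lemma frob_norm_eq_norm: "frob_norm M = norm M"
  by (simp add: frob_norm_def norm_vec_def L2_set_def sum_nonneg)

definition outer :: "real^'m \<Rightarrow> real^'n \<Rightarrow> real^'n^'m" where
  "outer u v = (\<chi> a. (u $ a) *\<^sub>R v)"

lemma outer_nth [simp]: "outer u v $ a = (u $ a) *\<^sub>R v"
  by (simp add: outer_def)

lemma norm_outer: "(norm (outer u v))\<^sup>2 = (norm u)\<^sup>2 * (norm v)\<^sup>2"
  by (simp add: power2_norm_eq_inner inner_vec_def[of "outer u v"] inner_vec_def[of u]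
      sum_distrib_left mult_ac)

lemma outer_inner: "outer u v \<bullet> Z = v \<bullet> (u v* Z)"
proof -
  have e: "u v* Z = (\<Sum>a\<in>UNIV. u $ a *\<^sub>R Z $ a)"
    by (simp add: vec_eq_iff vector_matrix_mult_def mult.commute)
  show ?thesis by (simp add: e inner_vec_def[of "outer u v"] inner_sum_right)
qed

lemma row_matrix_mult: "(M ** X) $ i = (M $ i) v* X"
  by (simp add: vec_eq_iff matrix_matrix_mult_def vector_matrix_mult_def mult.commute)

lemma vector_matrix_mult_nth: "(u v* Z) $ k = u \<bullet> column k Z"
  by (simp add: vector_matrix_mult_def column_def inner_vec_def mult.commute)

lemma norm_squared_columns: "(norm Z)\<^sup>2 = (\<Sum>k\<in>UNIV. column k Z \<bullet> column k Z)"
  for Z :: "real^'n^'m"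
  by (simp add: power2_norm_eq_inner inner_vec_def column_def) (rule sum.swap)

lemma linear_matrix_mult_right: "linear (\<lambda>X::real^'n^'r. A ** X)" for A :: "real^'r^'m"
  by (simp add: linear_iff matrix_add_ldistrib)
    (simp add: vec_eq_iff matrix_matrix_mult_def sum_distrib_left mult_ac)

text \<open>The product of the transpose of \<open>U\<close> with \<open>U\<close> is the identity,
  read as a sum over rows. This is the source of the isotropy of the samples.\<close>

lemma orthonormal_columns_inner:
  fixes U :: "real^'r^'N"
  assumes "\<And>j k. column j U \<bullet> column k U = (if j = k then 1 else 0)"
  shows "(\<Sum>i\<in>UNIV. (U $ i \<bullet> y) * (U $ i \<bullet> z)) = y \<bullet> z"
proof -
  have "(\<Sum>i\<in>UNIV. (U $ i \<bullet> y) * (U $ i \<bullet> z)) =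
    (\<Sum>i\<in>UNIV. \<Sum>j\<in>UNIV. \<Sum>k\<in>UNIV. y $ j * (z $ k * (U $ i $ j * U $ i $ k)))"
    by (simp add: inner_vec_def sum_product mult_ac)
  also have "\<dots> = (\<Sum>j\<in>UNIV. \<Sum>k\<in>UNIV. \<Sum>i\<in>UNIV. y $ j * (z $ k * (U $ i $ j * U $ i $ k)))"
    by (subst sum.swap) (intro sum.cong refl sum.swap)
  also have "\<dots> = (\<Sum>j\<in>UNIV. \<Sum>k\<in>UNIV. y $ j * (z $ k * (column j U \<bullet> column k U)))"
    by (simp add: inner_vec_def column_def sum_distrib_left)
  also have "\<dots> = y \<bullet> z"
  proof -
    have "y $ j * (z $ k * (if j = k then 1 else 0)) = (if j = k then y $ j * z $ j else 0)" for j k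
      by simp
    then show ?thesis by (simp add: assms inner_vec_def[of y])
  qed
  finally show ?thesis .
qed

lemma orthonormal_columns_norm:
  fixes U :: "real^'r^'N" and Z :: "real^'n^'r"
  assumes "\<And>j k. column j U \<bullet> column k U = (if j = k then 1 else 0)"
  shows "(norm (U ** Z))\<^sup>2 = (norm Z)\<^sup>2"
proof -
  have "(norm (U ** Z))\<^sup>2 = (\<Sum>i\<in>UNIV. \<Sum>k\<in>UNIV. (U $ i \<bullet> column k Z) * (U $ i \<bullet> column k Z))"
    by (simp add: power2_norm_eq_inner inner_vec_def[of "U ** Z"] row_matrix_mult
         inner_vec_def[of "_ v* Z"] vector_matrix_mult_nth)
  also have "\<dots> = (\<Sum>k\<in>UNIV. \<Sum>i\<in>UNIV. (U $ i \<bullet> column k Z) * (U $ i \<bullet> column k Z))"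
    by (rule sum.swap)
  finally show ?thesis by (simp add: orthonormal_columns_inner[OF assms] norm_squared_columns)
qed

lemma span_columns_subset_factor:
  fixes A :: "real^'r^'N" and U :: "real^'k^'N"
  assumes "span (columns U) \<subseteq> span (columns A)"
  shows "\<exists>G. U = A ** G"
proof -
  have "\<exists>g. column k U = A *v g" for k
  proof -
    have "column k U \<in> span (columns A)"
      using assms span_base[of "column k U" "columns U"] by (auto simp: columns_def)
    then show ?thesis by (auto simp: columns_image_basis linear_span_image[OF matrix_vector_mul_linear])
  qed
  then obtain g where g: "\<And>k. column k U = A *v g k" by metis
  have "U = A ** (\<chi> a k. g k $ a)"
  proof -
    have "U $ i $ k = column k U $ i" for i k by (simp add: column_def)
    then show ?thesis by (simp add: vec_eq_iff g matrix_vector_mult_def matrix_matrix_mult_def)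
  qed
  then show ?thesis ..
qed

text \<open>\<open>normal\<close> is the sketched normal equation tested with the error itself. It
  equates the quadratic part, bounded below column by column, with minus the inner product of
  \<open>T\<close> and \<open>Z\<close>; Cauchy-Schwarz then allows one factor \<open>norm Z\<close>
  to be cancelled.\<close>

lemma sketched_residual_bound:
  fixes U :: "real^'r^'N" and Z :: "real^'n^'r" and E :: "real^'n^'N" and c :: "nat \<Rightarrow> real"
  assumes lower: "\<And>y. \<tau> * (y \<bullet> y) \<le> (\<Sum>l<s. c l * (U $ \<xi> l \<bullet> y)\<^sup>2)"
    and normal: "(\<Sum>l<s. c l * ((U ** Z + E) $ \<xi> l \<bullet> (U ** Z) $ \<xi> l)) = 0"
    and \<tau>: "0 < \<tau>"
  shows "\<tau> * norm Z \<le> norm (\<Sum>l<s. c l *\<^sub>R outer (U $ \<xi> l) (E $ \<xi> l))"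
proof -
  define T where "T = (\<Sum>l<s. c l *\<^sub>R outer (U $ \<xi> l) (E $ \<xi> l))"
  define Q where "Q = (\<Sum>l<s. c l * ((U ** Z) $ \<xi> l \<bullet> (U ** Z) $ \<xi> l))"
  have "Q + T \<bullet> Z = 0"
    using normal by (simp add: Q_def T_def inner_sum_left outer_inner row_matrix_mult inner_add_left
        distrib_left sum.distrib)
  moreover have "\<tau> * (norm Z)\<^sup>2 \<le> Q"
  proof -
    have "\<tau> * (norm Z)\<^sup>2 = (\<Sum>k\<in>UNIV. \<tau> * (column k Z \<bullet> column k Z))"
      by (simp add: norm_squared_columns sum_distrib_left)
    also have "\<dots> \<le> (\<Sum>k\<in>UNIV. \<Sum>l<s. c l * (U $ \<xi> l \<bullet> column k Z)\<^sup>2)"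
      by (intro sum_mono lower)
    also have "\<dots> = Q"
      unfolding Q_def
      by (subst sum.swap) (simp add: row_matrix_mult inner_vec_def[of "_ v* Z"] vector_matrix_mult_nth
          sum_distrib_left power2_eq_square)
    finally show ?thesis .
  qed
  moreover have "- (T \<bullet> Z) \<le> norm T * norm Z"
    using Cauchy_Schwarz_ineq2[of T Z] by linarith
  ultimately have "(\<tau> * norm Z) * norm Z \<le> norm T * norm Z"
    by (simp add: power2_eq_square)
  then show ?thesis
    by (cases "Z = 0") (auto simp: T_def[symmetric])
qed

subsection \<open>Sampled least squares\<close>

lemma sample_const_pos: "0 < sample_const"
proof -
  \<comment> \<open>With \<open>ln 2\<close> at most 25/36, it suffices that 25/72 is below
    2/5.\<close>
  have "7 / 5 < sqrt 2" by (rule real_less_rsqrt) (simp add: power2_eq_square)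
  then show ?thesis using ln2_le_25_over_36 by (simp add: sample_const_def)
qed

text \<open>The origin of \<open>sample_const\<close>: it is the reciprocal of the Chernoff exponent
  at \<open>\<tau> = 1 / sqrt 2\<close>.\<close>

lemma Chernoff_exponent_inverse_sqrt2:
  "1 - 1 / sqrt 2 + 1 / sqrt 2 * ln (1 / sqrt 2) = 1 / sample_const"
proof -
  have *: "ln (1 / sqrt 2) = - (ln 2 / 2)" by (simp add: ln_div ln_sqrt)
  show ?thesis unfolding * by (simp add: sample_const_def field_simps)
qed

lemma sampled_row:
  assumes "j < s"
  shows "rows_mult (sampling_matrix s p \<xi>) M j = (1 / sqrt (real s * p $ \<xi> j)) *\<^sub>R M $ \<xi> j"
proof -
  have "(\<Sum>i\<in>UNIV. M $ i $ k * (if \<xi> j = i then c i else 0)) = M $ \<xi> j $ k * c (\<xi> j)" for k c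
    by (simp add: if_distrib cong: if_cong)
  then show ?thesis
    using assms by (simp add: rows_mult_def sampling_matrix_def vec_eq_iff vector_matrix_mult_def mult.commute)
qed

text \<open>Brings the objective on row families into the form of
  \<open>least_squares_normal_equation\<close>: one linear map per drawn row, with the weight inside
  it.\<close>

lemma sampled_objective:
  fixes A :: "real^'r^'N" and B :: "real^'n^'N" and X :: "real^'n^'r"
    and p :: "real^'N" and \<xi> :: "nat \<Rightarrow> 'N" and s :: nat
  defines "S \<equiv> sampling_matrix s p \<xi>" and "w \<equiv> \<lambda>j. 1 / sqrt (real s * p $ \<xi> j)"
  shows "(rows_frob_norm s (\<lambda>j. rows_mult (rows_mult S A) X j - rows_mult S B j))\<^sup>2 =
    (\<Sum>j<s. (norm (w j *\<^sub>R (A ** X) $ \<xi> j - w j *\<^sub>R B $ \<xi> j))\<^sup>2)"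
proof -
  let ?D = "\<lambda>j. rows_mult (rows_mult S A) X j - rows_mult S B j"
  have "?D j = w j *\<^sub>R (A ** X) $ \<xi> j - w j *\<^sub>R B $ \<xi> j" if "j < s" for j
  proof -
    have "rows_mult (rows_mult S A) X j = (w j *\<^sub>R A $ \<xi> j) v* X"
      unfolding rows_mult_def[of "rows_mult S A"] by (simp add: S_def w_def sampled_row[OF that])
    then show ?thesis
      by (simp add: S_def w_def sampled_row[OF that] row_matrix_mult scaleR_vector_matrix_assoc)
  qed
  moreover have "(rows_frob_norm s ?D)\<^sup>2 = (\<Sum>j<s. (norm (?D j))\<^sup>2)"
    by (simp add: rows_frob_norm_def norm_vec_def L2_set_def sum_nonneg)
  ultimately show ?thesis by simp
qed

text \<open>The event ranges over all minimisers of the sketched problem, so a rank-deficient sketch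
  with many minimisers is covered without selecting one.\<close>

theorem theorem3p12:
  fixes A :: "real^'r^'N" and B :: "real^'n^'N" and p :: "real^'N"
    and \<beta> \<epsilon> \<delta> :: real and s :: nat and Xopt :: "real^'n^'r"
  assumes "CARD('N) > CARD('r)"
    and "rank A = CARD('r)"
    and "\<forall>i. 0 \<le> p $ i \<and> p $ i \<le> 1"
    and "(\<Sum>i\<in>UNIV. p $ i) = 1"
    and "0 < \<beta>" and "\<beta> \<le> 1"
    and "\<forall>i. p $ i \<ge> \<beta> * leverage A i / real CARD('r)"
    and "0 < \<epsilon>" and "\<epsilon> < 1" and "0 < \<delta>" and "\<delta> < 1"
    and "s = nat \<lceil>real CARD('r) / \<beta> *
               max (sample_const * ln (2 * real CARD('r) / \<delta>)) (4 / (\<delta> * \<epsilon>))\<rceil>"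
    and "is_arg_min (\<lambda>X. (frob_norm (A ** X - B))\<^sup>2) (\<lambda>_. True) Xopt"
  shows "measure_pmf.prob (RandSample s p)
           {S. \<forall>Xt :: real^'n^'r.
                 is_arg_min
                   (\<lambda>X. (rows_frob_norm s
                           (\<lambda>j. rows_mult (rows_mult S A) X j - rows_mult S B j))\<^sup>2)
                   (\<lambda>_. True) Xt \<longrightarrow>
                 (frob_norm (A ** Xt - B))\<^sup>2 \<le> (1 + \<epsilon>) * (frob_norm (A ** Xopt - B))\<^sup>2}
         \<ge> 1 - \<delta>"
    (is "measure_pmf.prob _ ?Good \<ge> _")
proof -
  note \<beta> = assms(5) and \<epsilon> = assms(8) and \<delta> = assms(10)
  define r where "r = real CARD('r)"
  have r: "r > 0" by (simp add: r_def)
  obtain U where U: "orthonormal_colspace_basis A U"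
    using orthonormal_colspace_basis_exists[OF assms(2)] by blast
  have ON: "\<And>j k. column j U \<bullet> column k U = (if j = k then 1 else 0)"
    and sp: "span (columns U) = span (columns A)"
    using U by (auto simp: orthonormal_colspace_basis_def)
  \<comment> \<open>\<open>H\<close> carries the error into the coordinates of \<open>U\<close>;
    \<open>G\<close> transfers the orthogonality of the residual from the range of \<open>A\<close>
    to the columns of \<open>U\<close>.\<close>
  obtain H where H: "A = U ** H" using span_columns_subset_factor[of A U] sp by auto
  obtain G where G: "U = A ** G" using span_columns_subset_factor[of U A] sp by auto

  have s_ge: "r / \<beta> * max (sample_const * ln (2 * r / \<delta>)) (4 / (\<delta> * \<epsilon>)) \<le> real s"
    unfolding assms(12) r_def by (rule real_nat_ceiling_ge)
  have r\<beta>: "0 \<le> r / \<beta>" using r \<beta> by simp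
  have s1: "r / \<beta> * (sample_const * ln (2 * r / \<delta>)) \<le> real s"
    and s2: "r / \<beta> * (4 / (\<delta> * \<epsilon>)) \<le> real s"
    by (rule order_trans[OF mult_left_mono[OF max.cobounded1 r\<beta>] s_ge],
        rule order_trans[OF mult_left_mono[OF max.cobounded2 r\<beta>] s_ge])
  have "0 < r / \<beta> * (4 / (\<delta> * \<epsilon>))" using r \<beta> \<epsilon> \<delta> by simp
  with s2 have s: "0 < s" by linarith

  \<comment> \<open>The sampling distribution and its rescaled rows\<close>
  define q where "q = embed_pmf (\<lambda>i. p $ i)"
  have q: "pmf q i = p $ i" for i
    unfolding q_def
  proof (rule pmf_embed_pmf)
    have "(\<integral>\<^sup>+ i. ennreal (p $ i) \<partial>count_space UNIV) = (\<Sum>i\<in>UNIV. ennreal (p $ i))"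
      by (simp add: nn_integral_count_space_finite)
    also have "\<dots> = ennreal (\<Sum>i\<in>UNIV. p $ i)" using assms(3) by (intro sum_ennreal) auto
    finally show "(\<integral>\<^sup>+ i. ennreal (p $ i) \<partial>count_space UNIV) = 1" using assms(4) by simp
  qed (use assms(3) in auto)

  \<comment> \<open>The leverage hypothesis bounds the squared length of every rescaled row of
    \<open>U\<close> by this number.\<close>
  define R where "R = r / (\<beta> * s)"
  have R: "R > 0" using r \<beta> s by (simp add: R_def)
  define w where "w i = 1 / sqrt (real s * p $ i)" for i
  define c where "c i = 1 / (real s * p $ i)" for i
  have wc: "w i * w i = c i" for i using assms(3) by (simp add: w_def c_def)
  have c_nn: "0 \<le> c i" for i using assms(3) by (simp add: c_def)
  have lev: "U $ i \<bullet> U $ i \<le> r * p $ i / \<beta>" for i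
  proof -
    have "\<beta> * (U $ i \<bullet> U $ i) / r \<le> p $ i"
      using spec[OF assms(7), of i] leverage_eq[OF U, of i] by (simp add: r_def row_def power2_norm_eq_inner)
    then show ?thesis using \<beta> r by (simp add: field_simps)
  qed
  have cU: "c i * (U $ i \<bullet> U $ i) \<le> R" for i
  proof (cases "p $ i = 0")
    case True
    then show ?thesis using R by (simp add: c_def)
  next
    case False
    have "c i * (U $ i \<bullet> U $ i) \<le> c i * (r * p $ i / \<beta>)" using lev c_nn by (rule mult_left_mono)
    also have "\<dots> = R" using False s by (simp add: c_def R_def)
    finally show ?thesis .
  qed
  \<comment> \<open>A row of probability zero has leverage zero. Its weight is 0 by the convention
    for division by zero, and the vanishing row makes this default harmless in all averages.\<close>
  have U0: "U $ i = 0" if "p $ i = 0" for i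
    using lev[of i] that inner_ge_zero[of "U $ i"] by (simp add: antisym)
  have pc: "p $ i * (c i * t) = t / s" if "U $ i = 0 \<Longrightarrow> t = 0" for i t
    using U0[of i] that s by (cases "p $ i = 0") (auto simp: c_def)

  define x where "x i = w i *\<^sub>R U $ i" for i
  have x_in: "(x i \<bullet> y) * (x i \<bullet> z) = c i * ((U $ i \<bullet> y) * (U $ i \<bullet> z))" for i y z
    by (simp add: x_def flip: wc)
  have xR: "x i \<bullet> x i \<le> R" for i using cU[of i] by (simp add: x_def mult.assoc[symmetric] wc)
  have iso: "(\<Sum>i\<in>UNIV. pmf q i * ((x i \<bullet> y) * (x i \<bullet> z))) = (y \<bullet> z) / real s" for y z
    by (simp add: q x_in pc orthonormal_columns_inner[OF ON] flip: sum_divide_distrib)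

  \<comment> \<open>Centred summands built from the least-squares residual\<close>
  define E where "E = A ** Xopt - B"
  have E_orth: "E \<bullet> (A ** D) = 0" for D
    using assms(13)
      least_squares_normal_equation[where L = "\<lambda>_ X. A ** X" and I = "{()}" and b = "\<lambda>_. B" and X = Xopt and D = D]
    by (simp add: linear_matrix_mult_right E_def frob_norm_eq_norm)
  define z where "z i = c i *\<^sub>R outer (U $ i) (E $ i)" for i
  \<comment> \<open>Up to the factor \<open>1 / s\<close> this sum is the transpose of
    \<open>U\<close> times \<open>E\<close>; it is tested against every \<open>V\<close>, since
    \<open>U ** V\<close> lies in the range of \<open>X \<mapsto> A ** X\<close>.\<close>
  have mean: "(\<Sum>i\<in>UNIV. pmf q i *\<^sub>R z i) = 0"
  proof -
    have "(\<Sum>i\<in>UNIV. pmf q i *\<^sub>R z i) \<bullet> V = 0" for V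
    proof -
      have "(\<Sum>i\<in>UNIV. pmf q i *\<^sub>R z i) \<bullet> V = (\<Sum>i\<in>UNIV. E $ i \<bullet> (U $ i v* V) / s)"
      proof -
        have "(0::real^'r) v* V = 0" by (simp add: vec_eq_iff vector_matrix_mult_nth)
        then show ?thesis by (simp add: inner_sum_left z_def q outer_inner mult.assoc pc)
      qed
      also have "\<dots> = E \<bullet> (A ** (G ** V)) / s"
        by (simp add: inner_vec_def[of E] row_matrix_mult matrix_mul_assoc sum_divide_distrib flip: G)
      finally show ?thesis by (simp add: E_orth)
    qed
    then show ?thesis by (metis inner_eq_zero_iff)
  qed
  have second_moment: "real s * (\<Sum>i\<in>UNIV. pmf q i * (norm (z i))\<^sup>2) \<le> R * (norm E)\<^sup>2"
  proof -
    have "pmf q i * (norm (z i))\<^sup>2 \<le> R / s * (norm (E $ i))\<^sup>2" for i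
    proof -
      \<comment> \<open>One of the two factors \<open>c i\<close> cancels the probability, leaving
        \<open>1 / s\<close>; the other is absorbed by \<open>cU\<close>.\<close>
      have "pmf q i * (norm (z i))\<^sup>2 = p $ i * (c i * (c i * (norm (U $ i))\<^sup>2 * (norm (E $ i))\<^sup>2))"
        by (simp add: z_def q power_mult_distrib norm_outer power2_eq_square[of "c i"])
      also have "\<dots> = (c i * (U $ i \<bullet> U $ i)) * (norm (E $ i))\<^sup>2 / s"
        by (subst pc) (auto simp: power2_norm_eq_inner)
      also have "\<dots> \<le> R * (norm (E $ i))\<^sup>2 / s"
        by (intro divide_right_mono mult_right_mono cU) auto
      finally show ?thesis by simp
    qed
    then have "(\<Sum>i\<in>UNIV. pmf q i * (norm (z i))\<^sup>2) \<le> (\<Sum>i\<in>UNIV. R / s * (norm (E $ i))\<^sup>2)"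
      by (rule sum_mono)
    also have "\<dots> = R / s * (norm E)\<^sup>2"
      by (simp add: sum_distrib_left power2_norm_eq_inner inner_vec_def[of E])
    finally show ?thesis using s by (simp add: field_simps)
  qed

  \<comment> \<open>The two failure events and their probabilities\<close>
  define P where "P = Pi_pmf {..<s} undefined (\<lambda>_. q)"
  \<comment> \<open>Inverting \<open>\<tau>\<close> squared costs a factor 2, which the threshold
    \<open>\<epsilon> / 2\<close> in \<open>Bad2\<close> compensates.\<close>
  define \<tau> where "\<tau> = 1 / sqrt 2"
  define Bad1 where "Bad1 = {\<xi>. \<exists>y. (\<Sum>l<s. (x (\<xi> l) \<bullet> y)\<^sup>2) < \<tau> * (y \<bullet> y)}"
  define Bad2 where "Bad2 = {\<xi>. \<epsilon> / 2 * (norm E)\<^sup>2 < (norm (\<Sum>l<s. z (\<xi> l)))\<^sup>2}"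
  have \<tau>: "0 < \<tau>" "\<tau> < 1" by (simp_all add: \<tau>_def)

  have bad1: "measure_pmf.prob P Bad1 \<le> \<delta> / 2"
  proof -
    \<comment> \<open>Since \<open>1 / R\<close> is \<open>\<beta> * s / r\<close>, this is the
      first entry of the maximum defining \<open>s\<close>.\<close>
    have "ln (2 * r / \<delta>) \<le> 1 / sample_const / R"
      using s1 sample_const_pos r \<beta> s by (simp add: R_def field_simps)
    then have "- (1 / sample_const / R) \<le> - ln (2 * r / \<delta>)" by simp
    also have "- ln (2 * r / \<delta>) = ln (\<delta> / (2 * r))" using r \<delta> by (simp add: ln_div)
    finally have "exp (- (1 / sample_const / R)) \<le> \<delta> / (2 * r)"
      using r \<delta> by (simp add: ln_ge_iff)
    then have "r * exp (- (1 / sample_const / R)) \<le> \<delta> / 2" using r by (simp add: field_simps)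
    moreover have "measure_pmf.prob P Bad1 \<le> r * exp (- (1 / sample_const / R))"
      using rank1_Chernoff[OF xR R s iso \<tau>, of undefined]
      by (simp add: P_def Bad1_def r_def Chernoff_exponent_inverse_sqrt2[folded \<tau>_def])
    ultimately show ?thesis by linarith
  qed

  have moment: "measure_pmf.expectation P (\<lambda>\<xi>. (norm (\<Sum>l<s. z (\<xi> l)))\<^sup>2) \<le> R * (norm E)\<^sup>2"
    unfolding P_def expectation_norm_sum_squared[OF mean] by (rule second_moment)
  have bad2: "measure_pmf.prob P Bad2 \<le> \<delta> / 2"
  \<comment> \<open>For \<open>E = 0\<close> the Markov threshold would be 0; there the strict
    inequality makes the event empty.\<close>
  proof (cases "E = 0")
    case True
    have "outer u (0 :: real^'n) = 0" for u :: "real^'r" by (simp add: vec_eq_iff)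
    then have "Bad2 = {}" using True by (simp add: Bad2_def z_def)
    then show ?thesis using \<delta> by simp
  next
    case False
    then have E: "0 < (norm E)\<^sup>2" by simp
    have "measure_pmf.prob P Bad2 \<le>
       measure_pmf.expectation P (\<lambda>\<xi>. (norm (\<Sum>l<s. z (\<xi> l)))\<^sup>2) / (\<epsilon> / 2 * (norm E)\<^sup>2)"
      unfolding P_def using E \<epsilon> by (intro Markov_Pi_pmf) (auto simp: Bad2_def)
    also have "\<dots> \<le> R * (norm E)\<^sup>2 / (\<epsilon> / 2 * (norm E)\<^sup>2)"
      using moment E \<epsilon> by (intro divide_right_mono) auto
    also have "\<dots> = 2 * R / \<epsilon>" using E by simp
    \<comment> \<open>This is the second entry of the maximum defining \<open>s\<close>.\<close>
    also have "\<dots> \<le> \<delta> / 2"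
      using s2 r \<beta> \<epsilon> \<delta> s by (simp add: R_def field_simps)
    finally show ?thesis .
  qed

  \<comment> \<open>Deterministic error bound away from the failure events\<close>
  have good: "sampling_matrix s p \<xi> \<in> ?Good" if \<xi>: "\<xi> \<notin> Bad1 \<union> Bad2" for \<xi>
  proof (intro CollectI allI impI)
    fix Xt :: "real^'n^'r"
    assume "is_arg_min (\<lambda>X. (rows_frob_norm s
          (\<lambda>j. rows_mult (rows_mult (sampling_matrix s p \<xi>) A) X j -
               rows_mult (sampling_matrix s p \<xi>) B j))\<^sup>2) (\<lambda>_. True) Xt"
    then have min: "is_arg_min (\<lambda>X. \<Sum>j<s. (norm (w (\<xi> j) *\<^sub>R (A ** X) $ \<xi> j - w (\<xi> j) *\<^sub>R B $ \<xi> j))\<^sup>2)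
        (\<lambda>_. True) Xt"
      by (simp add: sampled_objective w_def)
    define Z where "Z = H ** (Xt - Xopt)"
    have UZ: "U ** Z = A ** (Xt - Xopt)" by (simp add: Z_def H matrix_mul_assoc)
    have "A ** (Xt - Xopt) = A ** Xt - A ** Xopt"
      by (rule linear_diff[OF linear_matrix_mult_right])
    then have res: "A ** Xt - B = U ** Z + E" by (simp add: UZ E_def)
    have "linear (\<lambda>X :: real^'n^'r. w (\<xi> j) *\<^sub>R (A ** X) $ \<xi> j)" for j
      using linear_matrix_mult_right[of A, where 'n = 'n]
      by (simp add: linear_iff scaleR_add_right mult.commute)
    from least_squares_normal_equation[OF this min, where D = "Xt - Xopt"]
    have normal: "(\<Sum>l<s. c (\<xi> l) * ((U ** Z + E) $ \<xi> l \<bullet> (U ** Z) $ \<xi> l)) = 0"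
      unfolding res[symmetric] unfolding UZ
      by (simp add: mult.assoc[symmetric] wc flip: scaleR_diff_right vector_minus_component)
    have lower: "\<tau> * (y \<bullet> y) \<le> (\<Sum>l<s. c (\<xi> l) * (U $ \<xi> l \<bullet> y)\<^sup>2)" for y
    proof -
      have "\<tau> * (y \<bullet> y) \<le> (\<Sum>l<s. (x (\<xi> l) \<bullet> y)\<^sup>2)" using \<xi> by (auto simp: Bad1_def not_less)
      then show ?thesis by (simp add: power2_eq_square x_in)
    qed
    have "\<tau> * norm Z \<le> norm (\<Sum>l<s. z (\<xi> l))"
      using sketched_residual_bound[OF lower normal \<tau>(1)] by (simp add: z_def)
    then have "(\<tau> * norm Z)\<^sup>2 \<le> (norm (\<Sum>l<s. z (\<xi> l)))\<^sup>2"
      using \<tau> by (intro power_mono) auto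
    also have "\<dots> \<le> \<epsilon> / 2 * (norm E)\<^sup>2" using \<xi> by (auto simp: Bad2_def not_less)
    finally have Z: "(norm Z)\<^sup>2 \<le> \<epsilon> * (norm E)\<^sup>2" by (simp add: \<tau>_def power_mult_distrib power_divide)
    have "(norm (U ** Z + E))\<^sup>2 = (norm (U ** Z))\<^sup>2 + (norm E)\<^sup>2"
      using E_orth[of "Xt - Xopt"] by (intro norm_add_Pythagorean) (simp add: orthogonal_def UZ inner_commute)
    also have "\<dots> \<le> (1 + \<epsilon>) * (norm E)\<^sup>2"
      using Z by (simp add: orthonormal_columns_norm[OF ON] algebra_simps)
    finally show "(frob_norm (A ** Xt - B))\<^sup>2 \<le> (1 + \<epsilon>) * (frob_norm (A ** Xopt - B))\<^sup>2"
      by (simp add: frob_norm_eq_norm res flip: E_def)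
  qed

  \<comment> \<open>Union bound and transfer to the random sketch\<close>
  have "1 - \<delta> \<le> 1 - measure_pmf.prob P (Bad1 \<union> Bad2)"
    using bad1 bad2 measure_Un_le[of Bad1 "measure_pmf P" Bad2] by simp
  also have "\<dots> = measure_pmf.prob P (- (Bad1 \<union> Bad2))"
    using measure_pmf.prob_compl[of "Bad1 \<union> Bad2" P] by (simp add: Compl_eq_Diff_UNIV)
  also have "\<dots> \<le> measure_pmf.prob P (sampling_matrix s p -` ?Good)"
    using good by (intro measure_pmf.finite_measure_mono) auto
  also have "\<dots> = measure_pmf.prob (RandSample s p) ?Good"
    by (simp add: RandSample_def P_def q_def measure_map_pmf)
  finally show ?thesis .
qed

end
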